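(* Let $W_1$ and $W_2$ be two admissible sequences such that $W_0=(W_1^+,W_2)$ is admissible too. Let $\lambda$ be a positive measure on $X$. Denote by $M_i$ the monomial corresponding to $W_i$, $\omega_{\pm i}=\omega_\pm(W_i)$, $\pi_i=\omega_{+i}$ and $\varrho_i=\omega_{-i}\setminus\omega_{+i}$ for $i=0,1,2$, so that $M_i\Phi\in\mathcal G_{\pi_i,\varrho_i}$. Then $\pi_1\cap\pi_2=\emptyset$ and $$\langle M_1\Phi,M_2\Phi\rangle_\lambda\;\lambda(\varrho_1\cup\varrho_2)=\langle M_1^+M_2\rangle\,\lambda(\varrho_0).$$
   Context: $X$ is a locally compact space, countable at infinity, $\mathfrak X=\{\emptyset\}+X+X^2+\cdots$ (disjoint union). Indices $b,c,\dots$ label variables $x_b,x_c,\dots\in X$; $x_\alpha=(x_c)_{c\in\alpha}$ for a finite index set $\alpha$; $+$ between index sets is disjoint union. $\varepsilon_x$ is the point measure at $x$, $\varepsilon(b,c)=\varepsilon_{x_b}(dx_c)$. Products of point measures. Let $S=\{(b_i,c_i):i\in I\}$ be a finite set of pairs of indices, the $b_i$ pairwise different, the $c_i$ pairwise different, $b_i\ne c_i$; $S_-=\{b_i\}$, $S_+=\{c_i\}$; $(b,c)\triangleright(b',c')\iff c=b'$ makes $S$ an oriented graph. If $S$ has no circuits, each $p\in S_-\setminus S_+$ starts a maximal chain $(p,c_{p,1}),(c_{p,1},c_{p,2}),\dots,(c_{p,k-1},c_{p,k})$; put $\pi_p=\{c_{p,1},\dots,c_{p,k}\}$ and $E_S=\prod_i\varepsilon(b_i,c_i):=\prod_{p\in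 S_-\setminus S_+}\varepsilon_{x_p}^{\otimes\#\pi_p}(dx_{\pi_p})$ ($E_\emptyset=1$). Finite particle vectors. $\Phi_\sigma(x_\upsilon)=\sum_{h:\sigma\to\upsilon\text{ bijective}}\prod_{b\in\sigma}\varepsilon(h(b),b)$ if $\#\sigma=\#\upsilon$, $0$ otherwise ($\upsilon\cap\sigma=\emptyset$); $\Phi=\Phi_\emptyset$. If $\sigma\cap S_+=\emptyset$ and $S$ has no circuits, $\Phi_\sigma E_S$ is the measure valued function with $(\Phi_\sigma E_S)(x_\upsilon)=\sum_h\prod_{b\in\sigma}\varepsilon(h(b),b)\prod_i\varepsilon(b_i,c_i)$: for given $x_\upsilon$ and $x_\varrho$ it is a measure on $X^\pi$, where $\pi=S_++\sigma$, $\varrho=S_-\setminus(S_++\sigma)$. $\mathcal G_{\pi,\varrho}$ is the set of finite sums of elements $\Phi_\sigma E_S$ with these $\pi,\varrho$. Operators: $a_c^+(\Phi_\sigma E_S)=\Phi_{\sigma+c}E_S$ ($c\notin\pi$), $a_c(\Phi_\sigma E_S)=\sum_{b\in\sigma}\varepsilon(c,b)\Phi_{\sigma\setminus b}E_S$ ($c\notin\pi+\varrho$), extended to finite sums. Admissible sequences. Write $a_c^{+1}=a_c^+$, $a_c^{-1}=a_c$. $W=(a^{\vartheta_n}_{c_n},\dots,a^{\vartheta_1}_{c_1})$, $\vartheta_i=\pm1$, is admissible if for all $i>j$ either $c_i\neq c_j$, or $c_i=c_j$, $\vartheta_i=1,\vartheta_j=-1$. The corresponding monomial is $M=a^{\vartheta_n}_{c_n}\cdots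 a^{\vartheta_1}_{c_1}$; $\omega_\pm(W)=\{c_i:\vartheta_i=\pm1\}$. The formal adjoint is $W^+=(a^{-\vartheta_1}_{c_1},\dots,a^{-\vartheta_n}_{c_n})$, with monomial $M^+$. Vacuum expectation. $\langle M\rangle=\sum_{\mathfrak p}\prod_i\varepsilon(c_{q_i},c_{r_i})$, the sum over all partitions $\mathfrak p$ of $\{1,\dots,n\}$ into pairs $\{q_i,r_i\}$ with $q_i>r_i$, $\vartheta_{q_i}=-1$, $\vartheta_{r_i}=+1$; it is $0$ if there are no such partitions and $1$ for the empty monomial. Pairing with $\lambda$. $\lambda(\alpha)=\lambda^{\otimes\alpha}(dx_\alpha)$. For $F_1\in\mathcal G_{\pi_1,\varrho_1}$, $F_2\in\mathcal G_{\pi_2,\varrho_2}$ with $\pi_1\cap\pi_2=\emptyset$, $(F_1F_2)(x_\alpha)$ is, for given $x_\alpha$ and $x_{\varrho_1\cup\varrho_2}$, the product measure of $F_1(x_\alpha)$ on $X^{\pi_1}$ and $F_2(x_\alpha)$ on $X^{\pi_2}$, and $\langle F_1,F_2\rangle_\lambda=\int(F_1F_2)(x_\alpha)\lambda(dx_\alpha)$, where $\int g(x_\alpha)\lambda(dx_\alpha)=g(\emptyset)+\sum_{n\ge1}\frac1{n!}\int_{X^n}g(x_1,\dots,x_n)\lambda(dx_1)\cdots\lambda(dx_n)$. Multiplying by $\lambda(\varrho_1\cup\varrho_2)$ gives a measure in all variables; similarly $\langle M\rangle\lambda(\omega_-(W)\setminus\omega_+(W))$. *)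

theory Defs
  imports "HOL-Probability.Probability" "HOL-Library.Infinite_Typeclass"
begin

section \<open>Measures on \<open>X\<^sup>\<pi>\<close>\<close>

text \<open>
  Positive measures on a locally compact space are Radon measures, given here by their
  Borel measures (Riesz representation).
\<close>

definition radon_measure :: "'a::t2_space measure \<Rightarrow> bool" where
  "radon_measure M \<longleftrightarrow>
     sets M = sets borel \<and>
     (\<forall>K. compact K \<longrightarrow> emeasure M K < \<infinity>) \<and>
     (\<forall>A \<in> sets borel. emeasure M A = (INF U \<in> {U. open U \<and> A \<subseteq> U}. emeasure M U)) \<and>
     (\<forall>U. open U \<longrightarrow> emeasure M U = (SUP K \<in> {K. compact K \<and> K \<subseteq> U}. emeasure M K))"

definition countable_at_infinity :: "'a::topological_space itself \<Rightarrow> bool" where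
  "countable_at_infinity _ \<longleftrightarrow>
     (\<exists>K :: nat \<Rightarrow> 'a set. (\<forall>n. compact (K n)) \<and> (\<Union>n. K n) = UNIV)"

text \<open>
  For a finite index set \<open>\<pi>\<close>, points \<open>x\<^sub>\<pi>\<close> are functions extensional on \<open>\<pi>\<close>, and measures in the
  variables \<open>x\<^sub>\<pi>\<close> live on the product of the Borel \<open>\<sigma>\<close>-algebras. A Radon measure on \<open>X\<^sup>\<pi>\<close> is
  determined by its restriction to this \<open>\<sigma>\<close>-algebra (Stone-Weierstrass), so nothing is lost if \<open>X\<close>
  is not second countable.
\<close>

definition prod_space :: "'i set \<Rightarrow> ('i \<Rightarrow> 'a::t2_space) measure" where
  "prod_space \<pi> = PiM \<pi> (\<lambda>_. borel)"

definition measure_on :: "'i set \<Rightarrow> (('i \<Rightarrow> 'a::t2_space) set \<Rightarrow> ennreal) \<Rightarrow> ('i \<Rightarrow> 'a) measure" where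
  "measure_on \<pi> \<mu> = measure_of (space (prod_space \<pi>)) (sets (prod_space \<pi>)) \<mu>"

definition lambda_pow :: "'a::t2_space measure \<Rightarrow> 'i set \<Rightarrow> ('i \<Rightarrow> 'a) measure" where
  "lambda_pow lam \<alpha> = PiM \<alpha> (\<lambda>_. lam)"

text \<open>
  \<open>measure_of\<close> is the null measure if \<open>\<mu>\<close> is not a measure. The set functions used
  below are finite sums of measures, or integrals of measures that depend measurably on a parameter.
\<close>

lemma space_measure_on [simp]: "space (measure_on \<pi> \<mu>) = space (prod_space \<pi>)"
  by (simp add: measure_on_def)

lemma sets_measure_on [simp]: "sets (measure_on \<pi> \<mu>) = sets (prod_space \<pi>)"
  by (simp add: measure_on_def)

lemma emeasure_measure_on_integral:
  fixes K :: "'a \<Rightarrow> ('b \<Rightarrow> 'c::t2_space) measure"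
  assumes "\<And>t. t \<in> space N \<Longrightarrow> sets (K t) = sets (prod_space \<pi>)"
    and "\<And>B. B \<in> sets (prod_space \<pi>) \<Longrightarrow> (\<lambda>t. emeasure (K t) B) \<in> borel_measurable N"
    and "A \<in> sets (prod_space \<pi>)"
  shows "emeasure (measure_on \<pi> (\<lambda>B. \<integral>\<^sup>+ t. emeasure (K t) B \<partial>N)) A = (\<integral>\<^sup>+ t. emeasure (K t) A \<partial>N)"
proof -
  have "countably_additive (sets (prod_space \<pi>)) (\<lambda>B. \<integral>\<^sup>+ t. emeasure (K t) B \<partial>N)"
    unfolding countably_additive_def
  proof safe
    fix B :: "nat \<Rightarrow> ('b \<Rightarrow> 'c) set"
    assume B: "range B \<subseteq> sets (prod_space \<pi>)" "disjoint_family B"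
    have "(\<Sum>i. \<integral>\<^sup>+ t. emeasure (K t) (B i) \<partial>N) = (\<integral>\<^sup>+ t. (\<Sum>i. emeasure (K t) (B i)) \<partial>N)"
      using B assms(2) by (intro nn_integral_suminf [symmetric]) auto
    also have "\<dots> = (\<integral>\<^sup>+ t. emeasure (K t) (\<Union>i. B i) \<partial>N)"
      using B assms(1) by (intro nn_integral_cong suminf_emeasure) auto
    finally show "(\<Sum>i. \<integral>\<^sup>+ t. emeasure (K t) (B i) \<partial>N) = (\<integral>\<^sup>+ t. emeasure (K t) (\<Union>i. B i) \<partial>N)" .
  qed
  moreover have "positive (sets (prod_space \<pi>)) (\<lambda>B. \<integral>\<^sup>+ t. emeasure (K t) B \<partial>N)"
    by (simp add: positive_def)
  ultimately show ?thesis
    unfolding measure_on_def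
    by (intro emeasure_measure_of_sigma sets.sigma_algebra_axioms assms(3))
qed

lemma emeasure_measure_on_sum:
  assumes "finite H" "\<And>h. h \<in> H \<Longrightarrow> sets (m h) = sets (prod_space \<pi>)"
    and "A \<in> sets (prod_space \<pi>)"
  shows "emeasure (measure_on \<pi> (\<lambda>B. \<Sum>h\<in>H. emeasure (m h) B)) A = (\<Sum>h\<in>H. emeasure (m h) A)"
  using emeasure_measure_on_integral [of "count_space H" m \<pi> A] assms
  by (simp add: nn_integral_count_space_finite)

lemma emeasure_measure_on_sum_mset:
  assumes "\<And>t. t \<in># F \<Longrightarrow> sets (m t) = sets (prod_space \<pi>)" and "A \<in> sets (prod_space \<pi>)"
  shows "emeasure (measure_on \<pi> (\<lambda>B. \<Sum>t\<in>#F. emeasure (m t) B)) A = (\<Sum>t\<in>#F. emeasure (m t) A)"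
proof -
  obtain xs where F: "F = mset xs"
    using ex_mset [of F] by blast
  have sum: "(\<Sum>t\<in>#F. emeasure (m t) B) = (\<Sum>i<length xs. emeasure (m (xs ! i)) B)" for B
  proof -
    have "(\<Sum>t\<in>#F. emeasure (m t) B) = sum_list (map (\<lambda>t. emeasure (m t) B) xs)"
      by (metis F mset_map sum_mset_sum_list)
    then show ?thesis
      by (simp add: sum_list_sum_nth atLeast0LessThan)
  qed
  show ?thesis
    unfolding sum using assms by (intro emeasure_measure_on_sum) (auto simp: F)
qed

section \<open>Products of point measures\<close>

abbreviation S_minus :: "('i \<times> 'i) set \<Rightarrow> 'i set" where "S_minus S \<equiv> fst ` S"
abbreviation S_plus :: "('i \<times> 'i) set \<Rightarrow> 'i set" where "S_plus S \<equiv> snd ` S"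

text \<open>
  A circuit \<open>(b\<^sub>1, b\<^sub>2) \<triangleright> (b\<^sub>2, b\<^sub>3) \<triangleright> \<dots> \<triangleright> (b\<^sub>k, b\<^sub>1)\<close> is a cycle of the relation \<open>S\<close>.
\<close>

definition epsilon_graph :: "('i \<times> 'i) set \<Rightarrow> bool" where
  "epsilon_graph S \<longleftrightarrow>
     finite S \<and> inj_on fst S \<and> inj_on snd S \<and> (\<forall>(b, c) \<in> S. b \<noteq> c) \<and> acyclic S"

definition chain_vertices :: "('i \<times> 'i) set \<Rightarrow> 'i \<Rightarrow> 'i set" where
  "chain_vertices S p = {c. (p, c) \<in> S\<^sup>+}"

definition chain_start :: "('i \<times> 'i) set \<Rightarrow> 'i \<Rightarrow> 'i" where
  "chain_start S c = (THE p. p \<in> S_minus S - S_plus S \<and> c \<in> chain_vertices S p)"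

lemma chain_start_unique:
  assumes S: "epsilon_graph S" and c: "c \<in> S_plus S"
  shows "\<exists>!p. p \<in> S_minus S - S_plus S \<and> c \<in> chain_vertices S p"
proof -
  have fin: "finite S" and acyc: "acyclic S" and inj: "inj_on snd S"
    using S by (auto simp: epsilon_graph_def)
  have wf: "wf S"
    using fin acyc by (rule finite_acyclic_wf)
  have ex: "c \<in> S_plus S \<Longrightarrow> \<exists>p. p \<in> S_minus S - S_plus S \<and> (p, c) \<in> S\<^sup>+" for c
  proof (induction c rule: wf_induct_rule [OF wf])
    case (1 c)
    then obtain b where b: "(b, c) \<in> S" by auto
    show ?case
    proof (cases "b \<in> S_plus S")
      case True
      then show ?thesis using 1(1) [OF b] b by (meson trancl.trancl_into_trancl)
    next
      case False
      then show ?thesis using b by (force intro: r_into_trancl)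
    qed
  qed
  have pred: "x = y" if "(x, z) \<in> S" "(y, z) \<in> S" for x y z
    using inj_onD [OF inj, of "(x, z)" "(y, z)"] that by simp
  have start: "p \<in> S_plus S" if "(q, p) \<in> S\<^sup>+" for p q
    using that by (cases rule: trancl.cases) force+
  have uniq: "(p, c) \<in> S\<^sup>+ \<Longrightarrow> (q, c) \<in> S\<^sup>+ \<Longrightarrow> p \<notin> S_plus S \<Longrightarrow> q \<notin> S_plus S \<Longrightarrow> p = q" for p q
  proof (induction arbitrary: q rule: trancl_induct)
    case (base y)
    show ?case
      using base(2)
    proof (cases rule: trancl.cases)
      case r_into_trancl
      then show ?thesis using pred base by blast
    next
      case (trancl_into_trancl z)
      then show ?thesis using pred start base by blast
    qed
  next
    case (step y z)
    show ?case
      using step.prems(1)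
    proof (cases rule: trancl.cases)
      case r_into_trancl
      then show ?thesis using pred start step by blast
    next
      case (trancl_into_trancl w)
      then show ?thesis using pred step by blast
    qed
  qed
  show ?thesis
    using ex [OF c] uniq by (auto simp: chain_vertices_def)
qed

text \<open>
  \<open>S\<^sub>+\<close> is the disjoint union of the sets \<open>\<pi>\<^sub>p\<close>, so the product over \<open>p\<close> of the powers
  \<open>\<epsilon>(x\<^sub>p)\<close> on \<open>X\<close> to the \<open>\<pi>\<^sub>p\<close> is one product over \<open>S\<^sub>+\<close>. Only the values \<open>x p\<close> with
  \<open>p \<in> S\<^sub>- - S\<^sub>+\<close> are used.
\<close>

definition eps_prod :: "('i \<times> 'i) set \<Rightarrow> ('i \<Rightarrow> 'a::t2_space) \<Rightarrow> ('i \<Rightarrow> 'a) measure" where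
  "eps_prod S x = PiM (S_plus S) (\<lambda>c. return borel (x (chain_start S c)))"

lemma sets_eps_prod [simp]: "sets (eps_prod S x) = sets (prod_space (S_plus S))"
  unfolding eps_prod_def prod_space_def by (rule sets_PiM_cong) simp_all

section \<open>Finite particle vectors\<close>

text \<open>
  \<open>F \<upsilon> x\<close> is the value \<open>F(x\<^sub>\<upsilon>)\<close>, for given \<open>x\<^sub>\<upsilon>\<close> and \<open>x\<^sub>\<rho>\<close>, both read off from \<open>x\<close>.
\<close>

type_synonym ('i, 'a) measure_fun = "'i set \<Rightarrow> ('i \<Rightarrow> 'a) \<Rightarrow> ('i \<Rightarrow> 'a) measure"

definition Phi_eps :: "'i set \<Rightarrow> ('i \<times> 'i) set \<Rightarrow> ('i, 'a::t2_space) measure_fun" where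
  "Phi_eps \<sigma> S \<upsilon> x = measure_on (S_plus S \<union> \<sigma>) (\<lambda>A.
     \<Sum>h \<in> {h \<in> \<sigma> \<rightarrow>\<^sub>E \<upsilon>. bij_betw h \<sigma> \<upsilon>}.
       emeasure (eps_prod ((\<lambda>b. (h b, b)) ` \<sigma> \<union> S) x) A)"

lemma emeasure_Phi_eps:
  assumes "finite \<sigma>" "finite \<upsilon>" "A \<in> sets (prod_space (S_plus S \<union> \<sigma>))"
  shows "emeasure (Phi_eps \<sigma> S \<upsilon> x) A =
    (\<Sum>h \<in> {h \<in> \<sigma> \<rightarrow>\<^sub>E \<upsilon>. bij_betw h \<sigma> \<upsilon>}.
       emeasure (eps_prod ((\<lambda>b. (h b, b)) ` \<sigma> \<union> S) x) A)"
  unfolding Phi_eps_def using assms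
  by (intro emeasure_measure_on_sum) (auto simp: finite_PiE image_Un image_image Un_commute)

text \<open>A finite sum of elements \<open>\<Phi>\<^sub>\<sigma> E\<^sub>S\<close> is given by the multiset of its summands \<open>(\<sigma>, S)\<close>.\<close>

type_synonym 'i particle_sum = "('i set \<times> ('i \<times> 'i) set) multiset"

definition sum_value :: "'i set \<Rightarrow> 'i particle_sum \<Rightarrow> ('i, 'a::t2_space) measure_fun" where
  "sum_value \<pi> F \<upsilon> x =
     measure_on \<pi> (\<lambda>A. \<Sum>(\<sigma>, S) \<in># F. emeasure (Phi_eps \<sigma> S \<upsilon> x) A)"

definition G_space :: "'i set \<Rightarrow> 'i set \<Rightarrow> ('i, 'a::t2_space) measure_fun set" where
  "G_space \<pi> \<rho> = {sum_value \<pi> F | F. \<forall>(\<sigma>, S) \<in># F.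
     finite \<sigma> \<and> epsilon_graph S \<and> \<sigma> \<inter> S_plus S = {} \<and>
     \<pi> = S_plus S \<union> \<sigma> \<and> \<rho> = S_minus S - (S_plus S \<union> \<sigma>)}"

definition Phi_vac :: "'i particle_sum" where
  "Phi_vac = {#({}, {})#}"

definition create :: "'i \<Rightarrow> 'i particle_sum \<Rightarrow> 'i particle_sum" where
  "create c F = image_mset (\<lambda>(\<sigma>, S). (insert c \<sigma>, S)) F"

definition annihilate :: "'i \<Rightarrow> 'i particle_sum \<Rightarrow> 'i particle_sum" where
  "annihilate c F =
     (\<Sum>(\<sigma>, S) \<in># F. image_mset (\<lambda>b. (\<sigma> - {b}, insert (c, b) S)) (mset_set \<sigma>))"

section \<open>Admissible sequences\<close>

datatype 'i oper = is_Create: Create (label: 'i) | is_Annih: Annih (label: 'i)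

text \<open>
  \<open>(a\<^sub>n, \<dots>, a\<^sub>1)\<close> is the list with head \<open>a\<^sub>n\<close>, so \<open>i > j\<close> means that \<open>a\<^sub>i\<close> stands
  before \<open>a\<^sub>j\<close> in the list.
\<close>

definition admissible :: "'i oper list \<Rightarrow> bool" where
  "admissible W \<longleftrightarrow> (\<forall>k l. k < l \<and> l < length W \<longrightarrow>
     label (W ! k) \<noteq> label (W ! l) \<or>
     (label (W ! k) = label (W ! l) \<and> is_Create (W ! k) \<and> is_Annih (W ! l)))"

definition omega_plus :: "'i oper list \<Rightarrow> 'i set" where
  "omega_plus W = {c. Create c \<in> set W}"

definition omega_minus :: "'i oper list \<Rightarrow> 'i set" where
  "omega_minus W = {c. Annih c \<in> set W}"

fun adjoint_oper :: "'i oper \<Rightarrow> 'i oper" where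
  "adjoint_oper (Create c) = Annih c"
| "adjoint_oper (Annih c) = Create c"

definition adjoint_seq :: "'i oper list \<Rightarrow> 'i oper list" where
  "adjoint_seq W = rev (map adjoint_oper W)"

fun apply_oper :: "'i oper \<Rightarrow> 'i particle_sum \<Rightarrow> 'i particle_sum" where
  "apply_oper (Create c) F = create c F"
| "apply_oper (Annih c) F = annihilate c F"

definition monomial_Phi :: "'i oper list \<Rightarrow> ('i, 'a::t2_space) measure_fun" where
  "monomial_Phi W = sum_value (omega_plus W) (foldr apply_oper W Phi_vac)"

section \<open>Vacuum expectation\<close>

definition pairings :: "'i oper list \<Rightarrow> nat set set set" where
  "pairings W = {P. partition_on {..<length W} P \<and>
     (\<forall>B \<in> P. \<exists>q r. B = {q, r} \<and> q < r \<and> is_Annih (W ! q) \<and> is_Create (W ! r))}"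

definition pairing_graph :: "'i oper list \<Rightarrow> nat set set \<Rightarrow> ('i \<times> 'i) set" where
  "pairing_graph W P = {(label (W ! q), label (W ! r)) | q r. {q, r} \<in> P \<and> q < r}"

text \<open>A measure in the variables \<open>\<omega>\<^sub>+(W)\<close>, for given \<open>x p\<close>, \<open>p \<in> \<omega>\<^sub>-(W) - \<omega>\<^sub>+(W)\<close>.\<close>

definition vacuum_expectation ::
    "'i oper list \<Rightarrow> ('i \<Rightarrow> 'a::t2_space) \<Rightarrow> ('i \<Rightarrow> 'a) measure" where
  "vacuum_expectation W x = measure_on (omega_plus W) (\<lambda>A.
     \<Sum>P \<in> pairings W. emeasure (eps_prod (pairing_graph W P) x) A)"

section \<open>Pairing with \<open>\<lambda>\<close>\<close>

definition fresh_indices :: "'i::infinite set \<Rightarrow> nat \<Rightarrow> 'i set" where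
  "fresh_indices V n = (SOME \<alpha>. finite \<alpha> \<and> card \<alpha> = n \<and> \<alpha> \<inter> V = {})"

text \<open>
  The integral of \<open>g(x\<^sub>\<alpha>)\<close> with respect to \<open>\<lambda>(dx\<^sub>\<alpha>)\<close>. The bound variables are named by
  index sets \<open>\<alpha>\<close> disjoint from the set \<open>V\<close> of the indices in use.
\<close>

definition lambda_integral ::
    "'a::t2_space measure \<Rightarrow> 'i::infinite set \<Rightarrow> ('i set \<Rightarrow> ('i \<Rightarrow> 'a) \<Rightarrow> ennreal) \<Rightarrow> ennreal" where
  "lambda_integral lam V g = g {} (\<lambda>_. undefined) +
     (\<Sum>n. ennreal (1 / fact (Suc n)) *
        (\<integral>\<^sup>+ y. g (fresh_indices V (Suc n)) y \<partial>lambda_pow lam (fresh_indices V (Suc n))))"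

definition product_measure ::
    "'i set \<Rightarrow> ('i \<Rightarrow> 'a::t2_space) measure \<Rightarrow> 'i set \<Rightarrow> ('i \<Rightarrow> 'a) measure \<Rightarrow> ('i \<Rightarrow> 'a) measure" where
  "product_measure \<pi>1 M1 \<pi>2 M2 = distr (M1 \<Otimes>\<^sub>M M2) (prod_space (\<pi>1 \<union> \<pi>2)) (merge \<pi>1 \<pi>2)"

text \<open>
  \<open>\<langle>F\<^sub>1, F\<^sub>2\<rangle>\<^sub>\<lambda>\<close> for \<open>F\<^sub>i\<close> in \<open>G_space \<pi>\<^sub>i \<rho>\<^sub>i\<close>: a measure in the variables \<open>\<pi>\<^sub>1 \<union> \<pi>\<^sub>2\<close>, for
  given values \<open>x\<close> of the variables \<open>\<rho>\<^sub>1 \<union> \<rho>\<^sub>2\<close>.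
\<close>

definition lambda_pairing ::
    "'a::t2_space measure \<Rightarrow> 'i::infinite set \<Rightarrow> 'i set \<Rightarrow> ('i, 'a) measure_fun \<Rightarrow>
       'i set \<Rightarrow> 'i set \<Rightarrow> ('i, 'a) measure_fun \<Rightarrow> ('i \<Rightarrow> 'a) \<Rightarrow> ('i \<Rightarrow> 'a) measure" where
  "lambda_pairing lam \<pi>1 \<rho>1 F1 \<pi>2 \<rho>2 F2 x = measure_on (\<pi>1 \<union> \<pi>2) (\<lambda>A.
     lambda_integral lam (\<pi>1 \<union> \<rho>1 \<union> \<pi>2 \<union> \<rho>2) (\<lambda>\<alpha> y.
       let z = merge \<alpha> (\<rho>1 \<union> \<rho>2) (y, x)
       in emeasure (product_measure \<pi>1 (F1 \<alpha> z) \<pi>2 (F2 \<alpha> z)) A))"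

text \<open>
  \<open>K \<lambda>(\<rho>)\<close>, a measure in the variables \<open>\<pi> \<union> \<rho>\<close>, where \<open>K x\<close> is a measure in the variables \<open>\<pi>\<close>
  for given \<open>x = x\<^sub>\<rho>\<close>.
\<close>

definition times_lambda ::
    "'a::t2_space measure \<Rightarrow> 'i set \<Rightarrow> 'i set \<Rightarrow> (('i \<Rightarrow> 'a) \<Rightarrow> ('i \<Rightarrow> 'a) measure) \<Rightarrow>
       ('i \<Rightarrow> 'a) measure" where
  "times_lambda lam \<pi> \<rho> K = measure_on (\<pi> \<union> \<rho>) (\<lambda>A.
     \<integral>\<^sup>+ x. emeasure (distr (K x) (prod_space (\<pi> \<union> \<rho>)) (\<lambda>y. merge \<pi> \<rho> (y, x))) A
       \<partial>lambda_pow lam \<rho>)"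

end

theory Submission
  imports Defs
begin

text \<open>
  All measures involved are finite sums of Dirac measures. A contraction of a sequence pairs each
  annihilator with a creator to its right; the vector \<open>M \<Phi>\<close> is the sum over all contractions, and
  \<open>\<langle>M\<rangle>\<close> is the sum over those that use up every creator.

  A contraction of \<open>W\<^sub>0\<close> using every creator consists of a contraction of \<open>W\<^sub>1\<close> with its edges
  reversed, a contraction of \<open>W\<^sub>2\<close>, and a bijection between the creators left over in \<open>W\<^sub>1\<close> and those
  left over in \<open>W\<^sub>2\<close>. In the pairing with \<open>\<lambda>\<close> this bijection appears as \<open>k\<inverse> \<circ> h\<close>, where \<open>h\<close> and \<open>k\<close>
  attach the left over creators to the bound variables \<open>x\<^sub>\<alpha>\<close>; each bijection arises from \<open>#\<alpha>!\<close> pairs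
  \<open>(h, k)\<close>, which cancels the factor \<open>1 / #\<alpha>!\<close>.

  After multiplication by \<open>\<lambda>\<close> at the starting points of the chains, the measure belonging to a graph
  is the image of a power of \<open>\<lambda>\<close> under the map that sends \<open>x\<close> to the values \<open>x\<close> takes at the roots.
  It depends only on the connected components, not on the choice of one root in each of them, so it is
  unchanged when edges are reversed or roots in \<open>\<alpha>\<close> are replaced by roots among the indices.
\<close>

section \<open>Contractions\<close>

lemma omega_plus_simps [simp]:
  "omega_plus [] = {}"
  "omega_plus (Create c # W) = insert c (omega_plus W)"
  "omega_plus (Annih c # W) = omega_plus W"
  "omega_plus (V @ W) = omega_plus V \<union> omega_plus W"
  by (auto simp: omega_plus_def)

lemma omega_minus_simps [simp]:
  "omega_minus [] = {}"
  "omega_minus (Create c # W) = omega_minus W"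
  "omega_minus (Annih c # W) = insert c (omega_minus W)"
  "omega_minus (V @ W) = omega_minus V \<union> omega_minus W"
  by (auto simp: omega_minus_def)

lemma finite_omega [simp]: "finite (omega_plus W)" "finite (omega_minus W)"
proof (induction W)
  case (Cons a W)
  { case 1 then show ?case using Cons by (cases a) auto }
  { case 2 then show ?case using Cons by (cases a) auto }
qed auto

lemma omega_adjoint_seq [simp]:
  "omega_plus (adjoint_seq W) = omega_minus W"
  "omega_minus (adjoint_seq W) = omega_plus W"
proof -
  have "omega_plus (adjoint_seq W) = omega_minus W \<and> omega_minus (adjoint_seq W) = omega_plus W"
  proof (induction W)
    case (Cons a W)
    then show ?case by (cases a) (auto simp: adjoint_seq_def)
  qed (auto simp: adjoint_seq_def)
  then show "omega_plus (adjoint_seq W) = omega_minus W" "omega_minus (adjoint_seq W) = omega_plus W"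
    by auto
qed

text \<open>A label can occur twice only as an annihilator with a creator of the same label to its
  left. Splitting off the leftmost operator gives this in the form used by the inductions over the
  list.\<close>

lemma admissible_ConsD:
  assumes "admissible (a # W)"
  shows "admissible W" and "label a \<notin> omega_plus W" and "is_Annih a \<Longrightarrow> label a \<notin> omega_minus W"
proof -
  show "admissible W"
    unfolding admissible_def
  proof (intro allI impI)
    fix k l assume "k < l \<and> l < length W"
    then show "label (W ! k) \<noteq> label (W ! l) \<or>
        label (W ! k) = label (W ! l) \<and> is_Create (W ! k) \<and> is_Annih (W ! l)"
      using assms[unfolded admissible_def, rule_format, of "Suc k" "Suc l"] by simp
  qed
  have *: "label a \<noteq> label b \<or> (is_Create a \<and> is_Annih b)" if b: "b \<in> set W" for b
  proof -
    obtain l where l: "l < length W" "W ! l = b"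
      using b unfolding in_set_conv_nth by blast
    then show ?thesis
      using assms[unfolded admissible_def, rule_format, of 0 "Suc l"] by simp
  qed
  show "label a \<notin> omega_plus W"
    using * by (force simp: omega_plus_def)
  show "is_Annih a \<Longrightarrow> label a \<notin> omega_minus W"
    using * by (cases a) (force simp: omega_minus_def)+
qed

text \<open>The one overlap left open is a creator in \<open>V\<close> with an annihilator of the
  same label in \<open>W\<close>. For \<open>adjoint_seq W1 @ W2\<close> it means that
  \<open>W1\<close> and \<open>W2\<close> may annihilate the same label.\<close>

lemma admissible_appendD:
  assumes "admissible (V @ W)"
  shows "omega_plus V \<inter> omega_plus W = {}" "omega_minus V \<inter> omega_plus W = {}"
    "omega_minus V \<inter> omega_minus W = {}"
proof -
  have "omega_plus V \<inter> omega_plus W = {} \<and> omega_minus V \<inter> omega_plus W = {} \<and>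
      omega_minus V \<inter> omega_minus W = {}"
    using assms
  proof (induction V)
    case (Cons a V)
    then show ?case
      using admissible_ConsD[of a "V @ W"] by (cases a) auto
  qed auto
  then show "omega_plus V \<inter> omega_plus W = {}" "omega_minus V \<inter> omega_plus W = {}"
    "omega_minus V \<inter> omega_minus W = {}" by auto
qed

section \<open>Contractible pairs and contractions\<close>

fun contractible :: "'i oper list \<Rightarrow> ('i \<times> 'i) set" where
  "contractible [] = {}"
| "contractible (Create c # W) = contractible W"
| "contractible (Annih c # W) = {c} \<times> omega_plus W \<union> contractible W"

text \<open>Edges join labels, not list positions; under admissibility a label together with its
  kind determines the position. Every annihilator must be paired, because an unpaired one would
  reach the vacuum and give zero, whereas unpaired creators are the particles that remain.\<close>

definition contractions :: "'i oper list \<Rightarrow> ('i \<times> 'i) set set" where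
  "contractions W = {S. S \<subseteq> contractible W \<and> inj_on fst S \<and> inj_on snd S \<and> fst ` S = omega_minus W}"

lemma contractible_subset: "contractible W \<subseteq> omega_minus W \<times> omega_plus W"
  by (induction W rule: contractible.induct) auto

lemma contractible_append:
  "contractible (V @ W) = contractible V \<union> omega_minus V \<times> omega_plus W \<union> contractible W"
  by (induction V rule: contractible.induct) auto

text \<open>The adjoint reverses the order and exchanges creators with annihilators, so a
  contractible pair stays contractible with its two roles exchanged.\<close>

lemma contractible_adjoint_seq: "contractible (adjoint_seq W) = (contractible W)\<inverse>"
proof (induction W)
  case (Cons a W)
  have "adjoint_seq (a # W) = adjoint_seq W @ [adjoint_oper a]"
    by (simp add: adjoint_seq_def)
  then show ?case
    using Cons by (cases a) (auto simp: contractible_append)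
qed (simp add: adjoint_seq_def)

text \<open>The link to list positions, needed because \<open>pairings\<close> are partitions of
  positions.\<close>

lemma contractible_iff_nth:
  "(a, b) \<in> contractible W \<longleftrightarrow> (\<exists>q r. q < r \<and> r < length W \<and> W ! q = Annih a \<and> W ! r = Create b)"
proof (induction W)
  case (Cons x W)
  have "(\<exists>q r. q < r \<and> r < length (x # W) \<and> (x # W) ! q = Annih a \<and> (x # W) ! r = Create b) \<longleftrightarrow>
      (x = Annih a \<and> b \<in> omega_plus W) \<or>
      (\<exists>q r. q < r \<and> r < length W \<and> W ! q = Annih a \<and> W ! r = Create b)" (is "?L \<longleftrightarrow> ?R")
  proof
    assume ?L
    then obtain q r where qr: "q < r" "r < length (x # W)" "(x # W) ! q = Annih a" "(x # W) ! r = Create b"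
      by blast
    then obtain r' where r': "r = Suc r'" by (cases r) auto
    then have r'': "r' < length W" "W ! r' = Create b" using qr by auto
    show ?R
    proof (cases q)
      case 0
      have "Create b \<in> set W" using r'' by (metis nth_mem)
      then show ?thesis using 0 qr by (simp add: omega_plus_def)
    next
      case (Suc q')
      then show ?thesis using qr r' r'' by auto
    qed
  next
    assume ?R
    then show ?L
    proof
      assume x: "x = Annih a \<and> b \<in> omega_plus W"
      then obtain r where "r < length W" "W ! r = Create b"
        by (auto simp: omega_plus_def in_set_conv_nth)
      then show ?L using x by (intro exI[of _ 0] exI[of _ "Suc r"]) auto
    next
      assume "\<exists>q r. q < r \<and> r < length W \<and> W ! q = Annih a \<and> W ! r = Create b"
      then obtain q r where "q < r \<and> r < length W \<and> W ! q = Annih a \<and> W ! r = Create b" by blast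
      then show ?L by (intro exI[of _ "Suc q"] exI[of _ "Suc r"]) auto
    qed
  qed
  then show ?case
    using Cons by (cases x) auto
qed simp

lemma finite_contractible [simp]: "finite (contractible W)"
  by (rule finite_subset[OF contractible_subset]) simp

lemma finite_contractions [simp]: "finite (contractions W)"
  by (rule finite_subset[of _ "Pow (contractible W)"]) (auto simp: contractions_def)

lemma acyclic_Domain_Range:
  assumes "Domain r \<inter> Range r = {}"
  shows "acyclic r"
proof (rule acyclicI, safe)
  fix x assume "(x, x) \<in> r\<^sup>+"
  then have "x \<in> Domain r" "x \<in> Range r"
    by (metis Domain.DomainI trancl_domain, metis Range.RangeI trancl_range)
  then show False using assms by blast
qed

text \<open>An annihilator put in front adds only edges that leave its label \<open>c\<close>, and
  no edge ends in \<open>c\<close>, since admissibility keeps \<open>c\<close> out of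
  \<open>omega_plus W\<close>. Hence no cycle can close.\<close>

lemma acyclic_contractible: "admissible W \<Longrightarrow> acyclic (contractible W)"
proof (induction W rule: contractible.induct)
  case (3 c W)
  note adm = admissible_ConsD[OF "3.prems"]
  have "acyclic ({c} \<times> omega_plus W)"
    using adm by (intro acyclic_Domain_Range) auto
  then have "wf ({c} \<times> omega_plus W)"
    by (intro finite_acyclic_wf) auto
  moreover have "wf (contractible W)"
    using "3.IH" adm by (intro finite_acyclic_wf) auto
  moreover have "Domain ({c} \<times> omega_plus W) \<inter> Range (contractible W) = {}"
    using adm contractible_subset[of W] by auto
  ultimately show ?case
    by (auto intro: wf_acyclic wf_Un)
next
  case (2 c W)
  then show ?case using admissible_ConsD by auto
qed (simp add: acyclic_def)

lemma epsilon_graph_contraction: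
  assumes "admissible W" "S \<in> contractions W"
  shows "epsilon_graph S"
proof -
  have S: "S \<subseteq> contractible W" "inj_on fst S" "inj_on snd S"
    using assms by (auto simp: contractions_def)
  have "acyclic S"
    using acyclic_contractible[OF assms(1)] S(1) by (rule acyclic_subset)
  moreover have "finite S"
    using finite_subset[OF S(1)] by simp
  moreover have "b \<noteq> c" if "(b, c) \<in> S" for b c
    using that \<open>acyclic S\<close> by (auto simp: acyclic_def)
  ultimately show ?thesis
    using S by (auto simp: epsilon_graph_def)
qed

lemma contraction_plus: "S \<in> contractions W \<Longrightarrow> snd ` S \<subseteq> omega_plus W"
  using contractible_subset[of W] by (auto simp: contractions_def)

lemma contraction_minus: "S \<in> contractions W \<Longrightarrow> fst ` S = omega_minus W"
  by (auto simp: contractions_def)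

text \<open>Distinct annihilators use up distinct creators, so all contractions leave the same
  number of creators free. This is why a single particle number survives in the integral over
  \<alpha>.\<close>

lemma card_contraction_complement:
  assumes "S \<in> contractions W"
  shows "card (omega_plus W - snd ` S) = card (omega_plus W) - card (omega_minus W)"
proof -
  have "card (omega_plus W - snd ` S) = card (omega_plus W) - card (snd ` S)"
    using contraction_plus[OF assms] finite_subset[OF contraction_plus[OF assms]]
    by (intro card_Diff_subset) auto
  also have "card (snd ` S) = card (fst ` S)"
    using assms unfolding contractions_def by (metis (mono_tags, lifting) card_image mem_Collect_eq)
  finally show ?thesis using contraction_minus[OF assms] by simp
qed

text \<open>A new leftmost annihilator may be contracted with any creator that is still free, and
  each contraction of the longer sequence arises in this way exactly once. This mirrors the action
  of \<open>annihilate\<close>.\<close>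

lemma contractions_Annih:
  assumes "c \<notin> omega_plus W" "c \<notin> omega_minus W"
  shows "bij_betw (\<lambda>(S, b). insert (c, b) S) (SIGMA S:contractions W. omega_plus W - snd ` S)
    (contractions (Annih c # W))"
\<comment> \<open>The inverse removes the unique edge that leaves \<open>c\<close> and returns its
  endpoint.\<close>
proof (rule bij_betwI[where g = "\<lambda>S. (S - {c} \<times> UNIV, THE b. (c, b) \<in> S)"])
  have c: "(c, b) \<notin> contractible W" for b
    using contractible_subset assms by fastforce
  have the: "(THE b. (c, b) \<in> S) = b" if "S \<in> contractions (Annih c # W)" "(c, b) \<in> S" for S b
  proof (rule the_equality)
    show "(c, b) \<in> S" by (rule that(2))
    fix b' assume "(c, b') \<in> S"
    then show "b' = b"
      using that inj_onD[of fst S "(c, b')" "(c, b)"] by (auto simp: contractions_def)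
  qed
  show "(\<lambda>(S, b). insert (c, b) S) \<in> (SIGMA S:contractions W. omega_plus W - snd ` S) \<rightarrow>
      contractions (Annih c # W)"
  proof safe
    fix S b assume S: "S \<in> contractions W" and b: "b \<in> omega_plus W" "b \<notin> snd ` S"
    have "c \<notin> fst ` S" using S assms by (simp add: contractions_def)
    then show "insert (c, b) S \<in> contractions (Annih c # W)"
      using S b by (auto simp: contractions_def)
  qed
  show "(\<lambda>S. (S - {c} \<times> UNIV, THE b. (c, b) \<in> S)) \<in> contractions (Annih c # W) \<rightarrow>
      (SIGMA S:contractions W. omega_plus W - snd ` S)"
  proof
    fix S assume S: "S \<in> contractions (Annih c # W)"
    then have "c \<in> fst ` S" by (simp add: contractions_def)
    then obtain b where b: "(c, b) \<in> S" by auto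
    have "b \<in> omega_plus W"
      using S b c by (auto simp: contractions_def)
    moreover have "b \<notin> snd ` (S - {c} \<times> UNIV)"
    proof
      assume "b \<in> snd ` (S - {c} \<times> UNIV)"
      then obtain a where a: "(a, b) \<in> S" "a \<noteq> c" by force
      then show False using S b inj_onD[of snd S "(a, b)" "(c, b)"] by (auto simp: contractions_def)
    qed
    moreover have "S - {c} \<times> UNIV \<in> contractions W"
    proof -
      have "fst ` (S - {c} \<times> UNIV) = fst ` S - {c}" by force
      also have "\<dots> = omega_minus W" using S assms by (simp add: contractions_def)
      finally show ?thesis
        using S by (auto simp: contractions_def intro: inj_on_subset)
    qed
    ultimately show "(S - {c} \<times> UNIV, THE b. (c, b) \<in> S) \<in> (SIGMA S:contractions W. omega_plus W - snd ` S)"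
      using the[OF S b] by auto
  qed
  show "(\<lambda>S. (S - {c} \<times> UNIV, THE b. (c, b) \<in> S)) ((\<lambda>(S, b). insert (c, b) S) x) = x"
    if "x \<in> (SIGMA S:contractions W. omega_plus W - snd ` S)" for x
  proof -
    obtain S b where x: "x = (S, b)" by force
    then have *: "c \<notin> fst ` S" using that assms by (auto simp: contractions_def)
    then have "insert (c, b) S - {c} \<times> UNIV = S" by force
    moreover have "(THE b'. (c, b') \<in> insert (c, b) S) = b"
      using * by (intro the_equality) force+
    ultimately show ?thesis using x by simp
  qed
  show "(\<lambda>(S, b). insert (c, b) S) ((\<lambda>S. (S - {c} \<times> UNIV, THE b. (c, b) \<in> S)) S) = S"
    if S: "S \<in> contractions (Annih c # W)" for S
  proof -
    have "c \<in> fst ` S" using S by (simp add: contractions_def)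
    then obtain b where b: "(c, b) \<in> S" by auto
    have "b' = b" if "(c, b') \<in> S" for b'
      using the[OF S b] the[OF S that] by simp
    then have "insert (c, b) (S - {c} \<times> UNIV) = S" using b by blast
    then show ?thesis by (simp only: prod.case the[OF S b])
  qed
qed

section \<open>Expansion of the vector \<open>M \<Phi>\<close> over contractions\<close>

lemma sum_mset_annihilate:
  "(\<Sum>t\<in>#annihilate c F. f t) =
    (\<Sum>t\<in>#F. \<Sum>b\<in>fst t. f (fst t - {b}, insert (c, b) (snd t)))"
proof (induction F)
  case (add t F)
  then show ?case
    by (cases t) (simp add: annihilate_def sum_unfold_sum_mset image_mset.compositionality o_def)
qed (simp add: annihilate_def)

text \<open>The multiset of summands is tested against an arbitrary \<open>f\<close>, so that the
  leftmost operator can be moved onto \<open>f\<close> and the induction hypothesis applied to the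
  modified function. The particles of a summand are the creators its contraction leaves
  free.\<close>

lemma sum_mset_foldr_apply_oper:
  assumes "admissible W"
  shows "(\<Sum>t\<in>#foldr apply_oper W Phi_vac. f t) =
    (\<Sum>S\<in>contractions W. f (omega_plus W - snd ` S, S))"
  using assms
proof (induction W arbitrary: f rule: contractible.induct)
  case 1
  have "contractions ([] :: 'a oper list) = {{}}" by (auto simp: contractions_def)
  then show ?case by (simp add: Phi_vac_def)
next
  case (2 c W)
  note adm = admissible_ConsD[OF "2.prems"]
  have "contractions (Create c # W) = contractions W"
    by (simp add: contractions_def)
  moreover have "(\<Sum>t\<in>#foldr apply_oper (Create c # W) Phi_vac. f t) =
      (\<Sum>t\<in>#foldr apply_oper W Phi_vac. f (insert c (fst t), snd t))"
    by (simp add: create_def image_mset.compositionality o_def case_prod_beta)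
  moreover have "insert c (omega_plus W - snd ` S) = insert c (omega_plus W) - snd ` S"
    if "S \<in> contractions W" for S
    using contraction_plus[OF that] adm by auto
  ultimately show ?case
    using "2.IH"[OF adm(1)] by (auto intro: sum.cong)
next
  case (3 c W)
  note adm = admissible_ConsD[OF "3.prems"]
  let ?f = "\<lambda>S. f (omega_plus W - snd ` S, S)"
  have "(\<Sum>t\<in>#foldr apply_oper (Annih c # W) Phi_vac. f t) =
      (\<Sum>S\<in>contractions W. \<Sum>b\<in>omega_plus W - snd ` S.
        f (omega_plus W - snd ` S - {b}, insert (c, b) S))"
    by (simp only: foldr.simps o_apply apply_oper.simps sum_mset_annihilate "3.IH"[OF adm(1)] fst_conv snd_conv)
  also have "\<dots> = (\<Sum>(S, b)\<in>(SIGMA S:contractions W. omega_plus W - snd ` S).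
        f (omega_plus W - snd ` S - {b}, insert (c, b) S))"
    by (intro sum.Sigma) auto
  also have "\<dots> = (\<Sum>(S, b)\<in>(SIGMA S:contractions W. omega_plus W - snd ` S).
        f (omega_plus W - snd ` insert (c, b) S, insert (c, b) S))"
    by (simp only: image_insert snd_conv Diff_insert[of _ _ "snd ` _"])
  also have "\<dots> = (\<Sum>p\<in>(SIGMA S:contractions W. omega_plus W - snd ` S). ?f ((\<lambda>(S, b). insert (c, b) S) p))"
    by (rule sum.cong) auto
  also have "\<dots> = (\<Sum>S\<in>contractions (Annih c # W). ?f S)"
    using adm by (intro sum.reindex_bij_betw contractions_Annih) auto
  finally show ?case by simp
qed

text \<open>Testing against singleton multisets turns the summation formula into an equation of
  multisets.\<close>

lemma foldr_apply_oper:
  assumes "admissible W"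
  shows "foldr apply_oper W Phi_vac =
    image_mset (\<lambda>S. (omega_plus W - snd ` S, S)) (mset_set (contractions W))"
  using sum_mset_foldr_apply_oper[OF assms, of "\<lambda>t. {#t#}"]
  by (simp only: Union_image_single_mset sum_unfold_sum_mset sum_mset_singleton_mset)

text \<open>All contractions have the same set of sources, and their targets together with the free
  creators always make up \<open>omega_plus W\<close>; so all summands share the same index
  sets.\<close>

lemma monomial_Phi_in_G_space:
  assumes "admissible W"
  shows "monomial_Phi W \<in> G_space (omega_plus W) (omega_minus W - omega_plus W)"
proof -
  have "\<forall>(\<sigma>, S) \<in># foldr apply_oper W Phi_vac. finite \<sigma> \<and> epsilon_graph S \<and> \<sigma> \<inter> S_plus S = {} \<and>
     omega_plus W = S_plus S \<union> \<sigma> \<and> omega_minus W - omega_plus W = S_minus S - (S_plus S \<union> \<sigma>)"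
    unfolding foldr_apply_oper[OF assms]
  proof
    fix t assume "t \<in># image_mset (\<lambda>S. (omega_plus W - snd ` S, S)) (mset_set (contractions W))"
    then obtain S where S: "S \<in> contractions W" and t: "t = (omega_plus W - snd ` S, S)"
      by auto
    have "omega_plus W = S_plus S \<union> (omega_plus W - S_plus S)"
      using contraction_plus[OF S] by blast
    then show "case t of (\<sigma>, S) \<Rightarrow> finite \<sigma> \<and> epsilon_graph S \<and> \<sigma> \<inter> S_plus S = {} \<and>
      omega_plus W = S_plus S \<union> \<sigma> \<and> omega_minus W - omega_plus W = S_minus S - (S_plus S \<union> \<sigma>)"
      using epsilon_graph_contraction[OF assms S] contraction_minus[OF S]
      unfolding t prod.case by (simp only: finite_Diff finite_omega) blast
  qed
  then show ?thesis
    unfolding monomial_Phi_def G_space_def mem_Collect_eq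
    by (intro exI[of _ "foldr apply_oper W Phi_vac"] conjI[OF refl])
qed

section \<open>Pairings of positions and contractions that use every creator\<close>

lemma admissible_nth_unique:
  assumes "admissible W" "q < length W" "q' < length W" "W ! q = W ! q'"
  shows "q = q'"
proof (rule ccontr)
  assume "q \<noteq> q'"
  then consider "q < q'" | "q' < q" by linarith
  then show False
    using assms(1)[unfolded admissible_def, rule_format, of q q']
      assms(1)[unfolded admissible_def, rule_format, of q' q] assms(2-)
    by cases (cases "W ! q'"; simp)+
qed

lemma pairing_nth:
  assumes P: "P \<in> pairings W" and qr: "{q, r} \<in> P" "q < r"
  shows "r < length W" "W ! q = Annih (label (W ! q))" "W ! r = Create (label (W ! r))"
proof -
  obtain q' r' where *: "{q, r} = {q', r'}" "q' < r'" "is_Annih (W ! q')" "is_Create (W ! r')"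
    using P qr unfolding pairings_def by blast
  then have "q' = q" "r' = r"
    using qr(2) by (auto simp: doubleton_eq_iff)
  then show "W ! q = Annih (label (W ! q))" "W ! r = Create (label (W ! r))"
    using * by simp_all
  show "r < length W"
    using P qr(1) unfolding pairings_def partition_on_def by blast
qed

lemma pairing_graph_iff:
  assumes P: "P \<in> pairings W"
  shows "(a, b) \<in> pairing_graph W P \<longleftrightarrow>
    (\<exists>q r. {q, r} \<in> P \<and> q < r \<and> r < length W \<and> W ! q = Annih a \<and> W ! r = Create b)"
proof
  assume "(a, b) \<in> pairing_graph W P"
  then obtain q r where "{q, r} \<in> P" "q < r" "a = label (W ! q)" "b = label (W ! r)"
    unfolding pairing_graph_def by blast
  then show "\<exists>q r. {q, r} \<in> P \<and> q < r \<and> r < length W \<and> W ! q = Annih a \<and> W ! r = Create b"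
    using pairing_nth[OF P] by metis
next
  assume "\<exists>q r. {q, r} \<in> P \<and> q < r \<and> r < length W \<and> W ! q = Annih a \<and> W ! r = Create b"
  then show "(a, b) \<in> pairing_graph W P"
    unfolding pairing_graph_def by force
qed

text \<open>By admissibility an operator occurs at one position only, so an edge between labels
  determines a pair of positions. That the blocks cover all positions says that every annihilator
  and every creator is used.\<close>

lemma bij_betw_pairing_graph:
  assumes adm: "admissible W"
  shows "bij_betw (pairing_graph W) (pairings W) {S \<in> contractions W. snd ` S = omega_plus W}"
proof (rule bij_betw_byWitness)
  \<comment> \<open>\<open>G\<close> is the inverse map: it turns each edge back into the block of
    the two positions that carry it.\<close>
  define G where "G S = {{q, r} | q r. q < r \<and> r < length W \<and>
    (\<exists>a b. W ! q = Annih a \<and> W ! r = Create b \<and> (a, b) \<in> S)}" for S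
  note uniq = admissible_nth_unique[OF adm]
  have block: "\<exists>q r. B = {q, r} \<and> q < r \<and> r < length W \<and> W ! q = Annih (label (W ! q)) \<and>
      W ! r = Create (label (W ! r))" if PB: "P \<in> pairings W" "B \<in> P" for P B
  proof -
    obtain q r where "B = {q, r}" "q < r"
      using PB unfolding pairings_def by blast
    then show ?thesis using pairing_nth[OF PB(1), of q r] PB(2) by blast
  qed
  have disj: "B = B'" if "P \<in> pairings W" "B \<in> P" "B' \<in> P" "x \<in> B" "x \<in> B'" for P B B' x
    using that unfolding pairings_def partition_on_def disjoint_def by blast
  have cover: "\<exists>B\<in>P. x \<in> B" if "P \<in> pairings W" "x < length W" for P x
    using that unfolding pairings_def partition_on_def by blast
  show "\<forall>P\<in>pairings W. G (pairing_graph W P) = P"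
  proof
    fix P assume P: "P \<in> pairings W"
    show "G (pairing_graph W P) = P"
    proof
      show "G (pairing_graph W P) \<subseteq> P"
      proof
        fix B assume "B \<in> G (pairing_graph W P)"
        then obtain q r a b where B: "B = {q, r}" "q < r" "r < length W" "W ! q = Annih a"
            "W ! r = Create b" "(a, b) \<in> pairing_graph W P"
          unfolding G_def by blast
        then obtain q' r' where *: "{q', r'} \<in> P" "q' < r'" "r' < length W" "W ! q' = Annih a"
            "W ! r' = Create b"
          unfolding pairing_graph_iff[OF P] by blast
        have "q' = q" "r' = r" using uniq B * by simp_all
        then show "B \<in> P" using B * by simp
      qed
      show "P \<subseteq> G (pairing_graph W P)"
      proof
        fix B assume B: "B \<in> P"
        then obtain q r where *: "B = {q, r}" "q < r" "r < length W" "W ! q = Annih (label (W ! q))"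
            "W ! r = Create (label (W ! r))"
          using block[OF P] by blast
        then have "(label (W ! q), label (W ! r)) \<in> pairing_graph W P"
          unfolding pairing_graph_iff[OF P] using B by blast
        then show "B \<in> G (pairing_graph W P)"
          unfolding G_def using * by blast
      qed
    qed
  qed
  have memG: "{q, r} \<in> G S \<longleftrightarrow> r < length W \<and>
      (\<exists>a b. W ! q = Annih a \<and> W ! r = Create b \<and> (a, b) \<in> S)" if "q < r" for q r S
    using that unfolding G_def by (auto simp: doubleton_eq_iff)
  have G: "G S \<in> pairings W" if "S \<in> contractions W" "snd ` S = omega_plus W" for S
  proof -
    have S: "S \<subseteq> contractible W" "inj_on fst S" "inj_on snd S" "fst ` S = omega_minus W"
      using that by (auto simp: contractions_def)
    have "\<Union>(G S) = {..<length W}"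
    proof (rule Set.equalityI)
      show "\<Union>(G S) \<subseteq> {..<length W}" by (auto simp: G_def)
      show "{..<length W} \<subseteq> \<Union>(G S)"
      proof
        fix x assume "x \<in> {..<length W}"
        then have x: "x < length W" by simp
        have "\<exists>a b. (a, b) \<in> S \<and> (W ! x = Annih a \<or> W ! x = Create b)"
        proof (cases "W ! x")
          case (Create b)
          then have "b \<in> snd ` S" using x that(2) nth_mem[OF x] by (simp add: omega_plus_def)
          then show ?thesis using Create by force
        next
          case (Annih a)
          then have "a \<in> fst ` S" using x S(4) nth_mem[OF x] by (simp add: omega_minus_def)
          then show ?thesis using Annih by force
        qed
        then obtain a b where ab: "(a, b) \<in> S" "W ! x = Annih a \<or> W ! x = Create b" by blast
        then obtain q r where qr: "q < r" "r < length W" "W ! q = Annih a" "W ! r = Create b"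
          using S(1) contractible_iff_nth[of a b W] by blast
        then have "{q, r} \<in> G S" using memG ab by blast
        moreover have "x = q \<or> x = r" using uniq[OF x] qr ab by auto
        ultimately show "x \<in> \<Union>(G S)" by blast
      qed
    qed
    moreover have "B = B'" if BB: "B \<in> G S" "B' \<in> G S" "x \<in> B" "x \<in> B'" for B B' x
    proof -
      obtain q r a b where B: "B = {q, r}" "q < r" "r < length W" "W ! q = Annih a"
          "W ! r = Create b" "(a, b) \<in> S"
        using BB unfolding G_def by blast
      obtain q' r' a' b' where B': "B' = {q', r'}" "q' < r'" "r' < length W" "W ! q' = Annih a'"
          "W ! r' = Create b'" "(a', b') \<in> S"
        using BB unfolding G_def by blast
      have "x = q \<or> x = r" "x = q' \<or> x = r'" using B B' BB by auto
      then have "a = a' \<or> b = b'" using B B' by auto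
      then have "a = a' \<and> b = b'"
        using inj_onD[OF S(2) _ B(6) B'(6)] inj_onD[OF S(3) _ B(6) B'(6)] by auto
      then have "q = q'" "r = r'" using uniq B B' by simp_all
      then show ?thesis using B B' by simp
    qed
    then have "disjoint (G S)" unfolding disjoint_def by blast
    moreover have "{} \<notin> G S" by (auto simp: G_def)
    moreover have "\<exists>q r. B = {q, r} \<and> q < r \<and> is_Annih (W ! q) \<and> is_Create (W ! r)" if B: "B \<in> G S" for B
    proof -
      obtain q r a b where "B = {q, r}" "q < r" "W ! q = Annih a" "W ! r = Create b"
        using B unfolding G_def by blast
      then show ?thesis by (intro exI[of _ q] exI[of _ r]) simp
    qed
    ultimately show ?thesis
      unfolding pairings_def partition_on_def by blast
  qed
  show "\<forall>S\<in>{S \<in> contractions W. snd ` S = omega_plus W}. pairing_graph W (G S) = S"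
  proof
    fix S assume "S \<in> {S \<in> contractions W. snd ` S = omega_plus W}"
    then have S: "S \<in> contractions W" "snd ` S = omega_plus W" by auto
    have "(a, b) \<in> pairing_graph W (G S) \<longleftrightarrow> (a, b) \<in> S" for a b
    proof
      assume "(a, b) \<in> pairing_graph W (G S)"
      then obtain q r where qr: "{q, r} \<in> G S" "q < r" "W ! q = Annih a" "W ! r = Create b"
        unfolding pairing_graph_iff[OF G[OF S]] by blast
      then show "(a, b) \<in> S" using memG by auto
    next
      assume ab: "(a, b) \<in> S"
      then obtain q r where "q < r" "r < length W" "W ! q = Annih a" "W ! r = Create b"
        using S contractible_iff_nth[of a b W] unfolding contractions_def by blast
      then show "(a, b) \<in> pairing_graph W (G S)"
        unfolding pairing_graph_iff[OF G[OF S]] using memG ab by blast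
    qed
    then show "pairing_graph W (G S) = S" by auto
  qed
  show "pairing_graph W ` pairings W \<subseteq> {S \<in> contractions W. snd ` S = omega_plus W}"
  proof safe
    fix P assume P: "P \<in> pairings W"
    note iff = pairing_graph_iff[OF P]
    have eq: "q = q' \<and> r = r'" if "{q, r} \<in> P" "{q', r'} \<in> P" "q < r" "q' < r'" "q = q' \<or> r = r'" for q r q' r'
    proof -
      have "{q, r} = {q', r'}" using disj[OF P that(1,2)] that(5) by blast
      then show ?thesis using that(3,4) by (auto simp: doubleton_eq_iff)
    qed
    have sub: "pairing_graph W P \<subseteq> contractible W"
    proof safe
      fix a b assume "(a, b) \<in> pairing_graph W P"
      then show "(a, b) \<in> contractible W"
        unfolding iff contractible_iff_nth by blast
    qed
    have inj: "a = a' \<and> b = b'" if ab: "(a, b) \<in> pairing_graph W P" "(a', b') \<in> pairing_graph W P"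
        "a = a' \<or> b = b'" for a b a' b'
    proof -
      obtain q r where 1: "{q, r} \<in> P" "q < r" "r < length W" "W ! q = Annih a" "W ! r = Create b"
        using ab(1) unfolding iff by blast
      obtain q' r' where 2: "{q', r'} \<in> P" "q' < r'" "r' < length W" "W ! q' = Annih a'" "W ! r' = Create b'"
        using ab(2) unfolding iff by blast
      have "q = q' \<or> r = r'"
        using ab(3) uniq[of q q'] uniq[of r r'] 1 2 by auto
      then have "q = q' \<and> r = r'" using eq[OF 1(1) 2(1) 1(2) 2(2)] by blast
      then show ?thesis using 1 2 by simp
    qed
    have minus: "fst ` pairing_graph W P = omega_minus W"
    proof
      show "fst ` pairing_graph W P \<subseteq> omega_minus W"
        using sub contractible_subset[of W] by fastforce
      show "omega_minus W \<subseteq> fst ` pairing_graph W P"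
      proof
        fix c assume "c \<in> omega_minus W"
        then obtain x where x: "x < length W" "W ! x = Annih c"
          unfolding omega_minus_def in_set_conv_nth by blast
        obtain B where B: "B \<in> P" "x \<in> B" using cover[OF P x(1)] by blast
        then obtain q r where qr: "B = {q, r}" "q < r" "r < length W" "W ! q = Annih (label (W ! q))"
            "W ! r = Create (label (W ! r))"
          using block[OF P B(1)] by blast
        have "x \<noteq> r" using qr x by auto
        then have "x = q" using B qr by blast
        then have "(c, label (W ! r)) \<in> pairing_graph W P"
          unfolding iff using qr B x by auto
        then show "c \<in> fst ` pairing_graph W P" by force
      qed
    qed
    show "snd x \<in> omega_plus W" if "x \<in> pairing_graph W P" for x
      using sub contractible_subset[of W] that by fastforce
    show "c \<in> snd ` pairing_graph W P" if c: "c \<in> omega_plus W" for c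
    proof -
      obtain x where x: "x < length W" "W ! x = Create c"
        using c unfolding omega_plus_def in_set_conv_nth by blast
      obtain B where B: "B \<in> P" "x \<in> B" using cover[OF P x(1)] by blast
      then obtain q r where qr: "B = {q, r}" "q < r" "r < length W" "W ! q = Annih (label (W ! q))"
          "W ! r = Create (label (W ! r))"
        using block[OF P B(1)] by blast
      have "x \<noteq> q" using qr x by auto
      then have "x = r" using B qr by blast
      then have "(label (W ! q), c) \<in> pairing_graph W P"
        unfolding iff using qr B x by auto
      then show ?thesis by force
    qed
    show "pairing_graph W P \<in> contractions W"
    proof -
      have "x = y" if "x \<in> pairing_graph W P" "y \<in> pairing_graph W P" "fst x = fst y \<or> snd x = snd y" for x y
        using inj[of "fst x" "snd x" "fst y" "snd y"] that by (simp add: prod_eq_iff)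
      then have "inj_on fst (pairing_graph W P)" "inj_on snd (pairing_graph W P)"
        by (simp_all add: inj_onI)
      then show ?thesis using sub minus by (simp only: contractions_def mem_Collect_eq simp_thms)
    qed
  qed
  show "G ` {S \<in> contractions W. snd ` S = omega_plus W} \<subseteq> pairings W"
    using G by blast
qed

section \<open>Roots of chains\<close>

text \<open>Extends \<open>chain_start\<close> by the identity to indices that are not targets, so
  that the variables integrated by \<lambda> have a root as well, namely themselves.\<close>

definition chain_root :: "('i \<times> 'i) set \<Rightarrow> 'i \<Rightarrow> 'i" where
  "chain_root S v = (if v \<in> S_plus S then chain_start S v else v)"

lemma chain_start_props:
  assumes "epsilon_graph S" "c \<in> S_plus S"
  shows "chain_start S c \<in> S_minus S - S_plus S" "(chain_start S c, c) \<in> S\<^sup>+"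
  using theI'[OF chain_start_unique[OF assms]] unfolding chain_start_def chain_vertices_def by auto

lemma chain_start_eqI:
  assumes "epsilon_graph S" "c \<in> S_plus S" "p \<in> S_minus S - S_plus S" "(p, c) \<in> S\<^sup>+"
  shows "chain_start S c = p"
  unfolding chain_start_def
  by (rule the1_equality[OF chain_start_unique[OF assms(1,2)]]) (use assms in \<open>simp add: chain_vertices_def\<close>)

lemma chain_root_in: "epsilon_graph S \<Longrightarrow> v \<in> S_plus S \<Longrightarrow> chain_root S v \<in> S_minus S - S_plus S"
  using chain_start_props(1)[of S v] by (simp add: chain_root_def)

lemma chain_root_id: "v \<notin> S_plus S \<Longrightarrow> chain_root S v = v"
  by (simp add: chain_root_def)

text \<open>A chain that reaches \<open>a\<close> continues to \<open>b\<close>; if nothing reaches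
  \<open>a\<close>, the edge itself begins a chain at \<open>a\<close>.\<close>

lemma chain_root_edge:
  assumes S: "epsilon_graph S" and ab: "(a, b) \<in> S"
  shows "chain_root S b = chain_root S a"
proof -
  have b: "b \<in> S_plus S" using ab by force
  show ?thesis
  proof (cases "a \<in> S_plus S")
    case True
    have "(chain_start S a, b) \<in> S\<^sup>+"
      using chain_start_props(2)[OF S True] ab by (rule trancl_into_trancl)
    then show ?thesis
      using chain_start_eqI[OF S b chain_start_props(1)[OF S True]] True b by (simp add: chain_root_def)
  next
    case False
    then have "a \<in> S_minus S - S_plus S" using ab by force
    then show ?thesis
      using chain_start_eqI[OF S b] ab False b by (auto simp add: chain_root_def)
  qed
qed

text \<open>Constancy along edges propagates along chains. With \<open>f\<close> built from the root
  map of another graph, this compares the roots of two graphs that have the same components.\<close>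

lemma chain_root_invariant:
  assumes S: "epsilon_graph S" and f: "\<And>a b. (a, b) \<in> S \<Longrightarrow> f b = f a"
  shows "f (chain_root S v) = f v"
proof (cases "v \<in> S_plus S")
  case True
  have "f y = f x" if "(x, y) \<in> S\<^sup>+" for x y
    using that by induction (auto simp: f)
  then show ?thesis
    using chain_start_props(2)[OF S True] True by (simp add: chain_root_def)
qed (simp add: chain_root_id)

section \<open>Sums of Dirac measures\<close>

text \<open>A substitution of variables: coordinate \<open>v\<close> receives the value of
  \<open>x\<close> at \<open>f v\<close>. With \<open>f\<close> a root map, this is the point that
  carries the mass of a product of point measures.\<close>

definition pull :: "('i \<Rightarrow> 'i) \<Rightarrow> 'i set \<Rightarrow> ('i \<Rightarrow> 'a) \<Rightarrow> 'i \<Rightarrow> 'a" where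
  "pull f V x = (\<lambda>v\<in>V. x (f v))"

lemma pull_space [simp]: "pull f V x \<in> space (prod_space V)"
  by (auto simp: pull_def prod_space_def space_PiM)

lemma eps_prod_eq_return:
  assumes "finite S"
  shows "eps_prod S x = return (prod_space (S_plus S)) (pull (chain_root S) (S_plus S) x)"
proof -
  have "eps_prod S x = return (prod_space (S_plus S)) (restrict (\<lambda>c. x (chain_start S c)) (S_plus S))"
    unfolding eps_prod_def prod_space_def using assms by (intro PiM_return) auto
  also have "restrict (\<lambda>c. x (chain_start S c)) (S_plus S) = pull (chain_root S) (S_plus S) x"
    by (auto simp: pull_def chain_root_def)
  finally show ?thesis .
qed

lemma emeasure_eps_prod:
  assumes "finite S" "A \<in> sets (prod_space (S_plus S))"
  shows "emeasure (eps_prod S x) A = indicator A (pull (chain_root S) (S_plus S) x)"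
  using assms by (simp add: eps_prod_eq_return)

text \<open>A finite sum of Dirac measures is the image of a counting measure under
  \<open>p\<close>. \<open>M\<close> is given only through its values on measurable sets because the
  vectors are built by \<open>measure_on\<close>.\<close>

lemma nn_integral_dirac_sum:
  assumes J: "finite J" and M: "sets M = sets N" and p: "\<And>j. j \<in> J \<Longrightarrow> p j \<in> space N"
    and eq: "\<And>A. A \<in> sets N \<Longrightarrow> emeasure M A = (\<Sum>j\<in>J. indicator A (p j))"
    and f: "f \<in> borel_measurable N"
  shows "(\<integral>\<^sup>+ z. f z \<partial>M) = (\<Sum>j\<in>J. f (p j))"
proof -
  have pm: "p \<in> count_space J \<rightarrow>\<^sub>M N" using p by (auto simp: measurable_def)
  have "M = distr (count_space J) N p"
  proof (rule measure_eqI)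
    fix A assume "A \<in> sets M"
    then have A: "A \<in> sets N" using M by simp
    have "emeasure (distr (count_space J) N p) A = (\<integral>\<^sup>+ z. indicator A z \<partial>distr (count_space J) N p)"
      using A by (simp add: nn_integral_indicator)
    also have "\<dots> = (\<Sum>j\<in>J. indicator A (p j))"
      using A J pm by (subst nn_integral_distr) (auto simp: nn_integral_count_space_finite)
    finally show "emeasure M A = emeasure (distr (count_space J) N p) A"
      using eq[OF A] by simp
  qed (simp add: M)
  then show ?thesis
    using f J pm by (simp add: nn_integral_distr nn_integral_count_space_finite)
qed

lemma emeasure_product_measure_dirac_sum:
  assumes J1: "finite J1" and M1: "sets M1 = sets (prod_space \<pi>1)"
    and p1: "\<And>j. j \<in> J1 \<Longrightarrow> p1 j \<in> space (prod_space \<pi>1)"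
    and eq1: "\<And>A. A \<in> sets (prod_space \<pi>1) \<Longrightarrow> emeasure M1 A = (\<Sum>j\<in>J1. indicator A (p1 j))"
    and J2: "finite J2" and M2: "sets M2 = sets (prod_space \<pi>2)"
    and p2: "\<And>j. j \<in> J2 \<Longrightarrow> p2 j \<in> space (prod_space \<pi>2)"
    and eq2: "\<And>A. A \<in> sets (prod_space \<pi>2) \<Longrightarrow> emeasure M2 A = (\<Sum>j\<in>J2. indicator A (p2 j))"
    and A: "A \<in> sets (prod_space (\<pi>1 \<union> \<pi>2))"
  shows "emeasure (product_measure \<pi>1 M1 \<pi>2 M2) A =
    (\<Sum>i\<in>J1. \<Sum>j\<in>J2. indicator A (merge \<pi>1 \<pi>2 (p1 i, p2 j)))"
proof -
  have space: "space M1 = space (prod_space \<pi>1)" "space M2 = space (prod_space \<pi>2)"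
    using M1 M2 by (auto dest: sets_eq_imp_space_eq)
  have mergeN: "merge \<pi>1 \<pi>2 \<in> prod_space \<pi>1 \<Otimes>\<^sub>M prod_space \<pi>2 \<rightarrow>\<^sub>M prod_space (\<pi>1 \<union> \<pi>2)"
    unfolding prod_space_def by (rule measurable_merge)
  then have mergeM: "merge \<pi>1 \<pi>2 \<in> M1 \<Otimes>\<^sub>M M2 \<rightarrow>\<^sub>M prod_space (\<pi>1 \<union> \<pi>2)"
    using measurable_cong_sets[OF sets_pair_measure_cong[OF M1 M2] refl] by blast
  \<comment> \<open>A finite sum of unit masses is finite; this supplies the sigma-finiteness by
    which the product measure is computed as an iterated integral.\<close>
  interpret M2: finite_measure M2
  proof
    have "emeasure M2 (space M2) = (\<Sum>j\<in>J2. indicator (space M2) (p2 j))"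
      using eq2[of "space (prod_space \<pi>2)"] space by simp
    also have "\<dots> \<noteq> \<infinity>" using J2 by (auto simp: indicator_def)
    finally show "emeasure M2 (space M2) \<noteq> \<infinity>" .
  qed
  let ?X = "merge \<pi>1 \<pi>2 -` A \<inter> space (M1 \<Otimes>\<^sub>M M2)"
  have "emeasure (product_measure \<pi>1 M1 \<pi>2 M2) A = emeasure (M1 \<Otimes>\<^sub>M M2) ?X"
    unfolding product_measure_def using mergeM A by (rule emeasure_distr)
  also have "\<dots> = (\<integral>\<^sup>+ x. \<integral>\<^sup>+ y. indicator ?X (x, y) \<partial>M2 \<partial>M1)"
    using mergeM A by (intro M2.emeasure_pair_measure measurable_sets)
  also have "\<dots> = (\<integral>\<^sup>+ x. \<integral>\<^sup>+ y. indicator A (merge \<pi>1 \<pi>2 (x, y)) \<partial>M2 \<partial>M1)"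
    by (intro nn_integral_cong) (auto simp: indicator_def space_pair_measure)
  also have "\<dots> = (\<integral>\<^sup>+ x. (\<Sum>j\<in>J2. indicator A (merge \<pi>1 \<pi>2 (x, p2 j))) \<partial>M1)"
  proof (intro nn_integral_cong nn_integral_dirac_sum[OF J2 M2 p2 eq2])
    fix x assume "x \<in> space M1"
    then have "Pair x \<in> prod_space \<pi>2 \<rightarrow>\<^sub>M prod_space \<pi>1 \<Otimes>\<^sub>M prod_space \<pi>2"
      using space by (intro measurable_Pair1') simp
    from measurable_compose[OF measurable_compose[OF this mergeN] borel_measurable_indicator[OF A]]
    show "(\<lambda>y. indicator A (merge \<pi>1 \<pi>2 (x, y)) :: ennreal) \<in> borel_measurable (prod_space \<pi>2)" .
  qed
  also have "\<dots> = (\<Sum>i\<in>J1. \<Sum>j\<in>J2. indicator A (merge \<pi>1 \<pi>2 (p1 i, p2 j)))"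
  proof (intro nn_integral_dirac_sum[OF J1 M1 p1 eq1] borel_measurable_sum)
    fix j assume "j \<in> J2"
    then have "(\<lambda>x. (x, p2 j)) \<in> prod_space \<pi>1 \<rightarrow>\<^sub>M prod_space \<pi>1 \<Otimes>\<^sub>M prod_space \<pi>2"
      using p2 by (intro measurable_Pair2') simp
    from measurable_compose[OF measurable_compose[OF this mergeN] borel_measurable_indicator[OF A]]
    show "(\<lambda>x. indicator A (merge \<pi>1 \<pi>2 (x, p2 j)) :: ennreal) \<in> borel_measurable (prod_space \<pi>1)" .
  qed
  finally show ?thesis .
qed

section \<open>Finite particle vectors as sums over contractions\<close>

definition bijections :: "'i set \<Rightarrow> 'i set \<Rightarrow> ('i \<Rightarrow> 'i) set" where
  "bijections \<sigma> \<upsilon> = {h \<in> \<sigma> \<rightarrow>\<^sub>E \<upsilon>. bij_betw h \<sigma> \<upsilon>}"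

lemma finite_bijections [simp]: "finite \<sigma> \<Longrightarrow> finite \<upsilon> \<Longrightarrow> finite (bijections \<sigma> \<upsilon>)"
  by (simp add: bijections_def finite_PiE)

text \<open>Composition with one fixed bijection \<open>g\<close> identifies the bijections from
  \<sigma> to \<upsilon> with the permutations of \<upsilon>.\<close>

lemma card_bijections:
  assumes "finite \<sigma>" "finite \<upsilon>" "card \<sigma> = card \<upsilon>"
  shows "card (bijections \<sigma> \<upsilon>) = fact (card \<upsilon>)"
proof -
  obtain g where g: "bij_betw g \<sigma> \<upsilon>"
    using assms finite_same_card_bij by blast
  have "bij_betw (\<lambda>p. \<lambda>b\<in>\<sigma>. p (g b)) {p. p permutes \<upsilon>} (bijections \<sigma> \<upsilon>)"
  \<comment> \<open>The two sides have different defaults outside their domains: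
    \<open>permutes\<close> asks for the identity, \<open>PiE\<close> for
    \<open>undefined\<close>.\<close>
  proof (rule bij_betwI[where g = "\<lambda>h x. if x \<in> \<upsilon> then h (inv_into \<sigma> g x) else x"])
    show "(\<lambda>p. \<lambda>b\<in>\<sigma>. p (g b)) \<in> {p. p permutes \<upsilon>} \<rightarrow> bijections \<sigma> \<upsilon>"
    proof
      fix p assume "p \<in> {p. p permutes \<upsilon>}"
      then have "bij_betw (p \<circ> g) \<sigma> \<upsilon>"
        using g by (auto intro: bij_betw_trans permutes_imp_bij)
      then have "bij_betw (\<lambda>b\<in>\<sigma>. p (g b)) \<sigma> \<upsilon>"
        by (subst bij_betw_cong[of \<sigma> _ "p \<circ> g"]) auto
      then show "(\<lambda>b\<in>\<sigma>. p (g b)) \<in> bijections \<sigma> \<upsilon>"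
        by (auto simp: bijections_def dest: bij_betwE)
    qed
    show "(\<lambda>h x. if x \<in> \<upsilon> then h (inv_into \<sigma> g x) else x) \<in> bijections \<sigma> \<upsilon> \<rightarrow> {p. p permutes \<upsilon>}"
    proof
      fix h assume "h \<in> bijections \<sigma> \<upsilon>"
      then have "bij_betw (h \<circ> inv_into \<sigma> g) \<upsilon> \<upsilon>"
        using g by (auto simp: bijections_def intro: bij_betw_trans bij_betw_inv_into)
      then have "bij_betw (\<lambda>x. if x \<in> \<upsilon> then h (inv_into \<sigma> g x) else x) \<upsilon> \<upsilon>"
        by (subst bij_betw_cong[of \<upsilon> _ "h \<circ> inv_into \<sigma> g"]) auto
      then show "(\<lambda>x. if x \<in> \<upsilon> then h (inv_into \<sigma> g x) else x) \<in> {p. p permutes \<upsilon>}"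
        by (auto intro: bij_imp_permutes)
    qed
    show "(\<lambda>x. if x \<in> \<upsilon> then (\<lambda>b\<in>\<sigma>. p (g b)) (inv_into \<sigma> g x) else x) = p"
      if "p \<in> {p. p permutes \<upsilon>}" for p
      using that g by (auto simp: fun_eq_iff permutes_not_in bij_betw_inv_into_right
          dest: bij_betwE[OF bij_betw_inv_into])
    show "(\<lambda>b\<in>\<sigma>. if g b \<in> \<upsilon> then h (inv_into \<sigma> g (g b)) else g b) = h"
      if h: "h \<in> bijections \<sigma> \<upsilon>" for h
    proof
      fix b
      show "(\<lambda>b\<in>\<sigma>. if g b \<in> \<upsilon> then h (inv_into \<sigma> g (g b)) else g b) b = h b"
      proof (cases "b \<in> \<sigma>")
        case True
        then show ?thesis
          using bij_betwE[OF g] bij_betw_inv_into_left[OF g True] by simp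
      next
        case False
        have "h \<in> \<sigma> \<rightarrow>\<^sub>E \<upsilon>" using h by (simp add: bijections_def)
        from PiE_arb[OF this False] show ?thesis using False by simp
      qed
    qed
  qed
  then show ?thesis
    using bij_betw_same_card card_permutations[OF refl assms(2)] by metis
qed

text \<open>Indexes the point masses in the value of \<open>M \<Phi>\<close> at
  \<open>\<upsilon>\<close>: a contraction, and an assignment of its free creators to the variables
  in \<upsilon>. The graph below hangs each free creator on its variable, as in
  \<open>Phi_eps\<close>.\<close>

definition particle_terms :: "'i oper list \<Rightarrow> 'i set \<Rightarrow> (('i \<times> 'i) set \<times> ('i \<Rightarrow> 'i)) set" where
  "particle_terms W \<upsilon> = (SIGMA S:contractions W. bijections (omega_plus W - snd ` S) \<upsilon>)"

definition particle_graph :: "'i oper list \<Rightarrow> ('i \<times> 'i) set \<times> ('i \<Rightarrow> 'i) \<Rightarrow> ('i \<times> 'i) set" where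
  "particle_graph W j = (\<lambda>b. (snd j b, b)) ` (omega_plus W - snd ` fst j) \<union> fst j"

lemma finite_particle_terms [simp]: "finite \<upsilon> \<Longrightarrow> finite (particle_terms W \<upsilon>)"
  by (auto simp: particle_terms_def)

lemma S_plus_particle_graph:
  assumes "j \<in> particle_terms W \<upsilon>"
  shows "S_plus (particle_graph W j) = omega_plus W"
proof -
  have "S_plus (particle_graph W j) = (omega_plus W - S_plus (fst j)) \<union> S_plus (fst j)"
    by (simp only: particle_graph_def image_Un image_image snd_conv image_ident)
  also have "\<dots> = omega_plus W"
  proof -
    have "fst j \<in> contractions W" using assms by (auto simp: particle_terms_def)
    from contraction_plus[OF this] show ?thesis by blast
  qed
  finally show ?thesis .
qed

lemma S_minus_particle_graph:
  assumes "j \<in> particle_terms W \<upsilon>"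
  shows "S_minus (particle_graph W j) = \<upsilon> \<union> omega_minus W"
proof -
  have "S_minus (particle_graph W j) = snd j ` (omega_plus W - S_plus (fst j)) \<union> S_minus (fst j)"
    by (simp only: particle_graph_def image_Un image_image fst_conv)
  also have "snd j ` (omega_plus W - S_plus (fst j)) = \<upsilon>"
    using assms by (auto simp: particle_terms_def bijections_def bij_betw_def)
  also have "S_minus (fst j) = omega_minus W"
    using assms by (intro contraction_minus) (auto simp: particle_terms_def)
  finally show ?thesis .
qed

text \<open>The expansion over contractions is combined with the sum over bijections inside
  \<open>Phi_eps\<close>; what remains in each term is one point mass at the tuple of roots.\<close>

lemma emeasure_monomial_Phi:
  assumes adm: "admissible W" and \<upsilon>: "finite \<upsilon>" and A: "A \<in> sets (prod_space (omega_plus W))"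
  shows "emeasure (monomial_Phi W \<upsilon> x) A =
    (\<Sum>j\<in>particle_terms W \<upsilon>. indicator A (pull (chain_root (particle_graph W j)) (omega_plus W) x))"
proof -
  have eq: "S_plus S \<union> omega_plus W = omega_plus W" if "S \<in> contractions W" for S
    using contraction_plus[OF that] by blast
  have "emeasure (monomial_Phi W \<upsilon> x) A =
      (\<Sum>t\<in>#foldr apply_oper W Phi_vac. emeasure (Phi_eps (fst t) (snd t) \<upsilon> x) A)"
  proof -
    have "sets (Phi_eps (fst t) (snd t) \<upsilon> x) = sets (prod_space (omega_plus W))"
      if "t \<in># foldr apply_oper W Phi_vac" for t
      using that unfolding foldr_apply_oper[OF adm] by (auto simp: Phi_eps_def eq)
    then show ?thesis
      unfolding monomial_Phi_def sum_value_def case_prod_beta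
      using A by (intro emeasure_measure_on_sum_mset)
  qed
  also have "\<dots> = (\<Sum>S\<in>contractions W. emeasure (Phi_eps (omega_plus W - snd ` S) S \<upsilon> x) A)"
    by (subst sum_mset_foldr_apply_oper[OF adm]) simp
  also have "\<dots> = (\<Sum>S\<in>contractions W. \<Sum>h\<in>bijections (omega_plus W - snd ` S) \<upsilon>.
      indicator A (pull (chain_root (particle_graph W (S, h))) (omega_plus W) x))"
  proof (rule sum.cong[OF refl])
    fix S assume S: "S \<in> contractions W"
    have fin: "finite S" using S adm epsilon_graph_contraction by (auto simp: epsilon_graph_def)
    have "emeasure (Phi_eps (omega_plus W - snd ` S) S \<upsilon> x) A =
        (\<Sum>h\<in>bijections (omega_plus W - snd ` S) \<upsilon>. emeasure (eps_prod (particle_graph W (S, h)) x) A)"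
      using \<upsilon> A by (subst emeasure_Phi_eps) (simp_all add: eq[OF S] bijections_def particle_graph_def)
    also have "\<dots> = (\<Sum>h\<in>bijections (omega_plus W - snd ` S) \<upsilon>.
      indicator A (pull (chain_root (particle_graph W (S, h))) (omega_plus W) x))"
    proof (rule sum.cong[OF refl])
      fix h assume "h \<in> bijections (omega_plus W - snd ` S) \<upsilon>"
      then have j: "(S, h) \<in> particle_terms W \<upsilon>" using S by (simp add: particle_terms_def)
      show "emeasure (eps_prod (particle_graph W (S, h)) x) A =
        indicator A (pull (chain_root (particle_graph W (S, h))) (omega_plus W) x)"
        using emeasure_eps_prod[of "particle_graph W (S, h)" A x] fin A
        unfolding S_plus_particle_graph[OF j] by (simp add: particle_graph_def)
    qed
    finally show "emeasure (Phi_eps (omega_plus W - snd ` S) S \<upsilon> x) A =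
       (\<Sum>h\<in>bijections (omega_plus W - snd ` S) \<upsilon>.
      indicator A (pull (chain_root (particle_graph W (S, h))) (omega_plus W) x))" .
  qed
  also have "\<dots> = (\<Sum>j\<in>particle_terms W \<upsilon>. indicator A (pull (chain_root (particle_graph W j)) (omega_plus W) x))"
    unfolding particle_terms_def using \<upsilon> by (subst sum.Sigma) (auto simp: case_prod_beta)
  finally show ?thesis .
qed

lemma sets_monomial_Phi [simp]: "sets (monomial_Phi W \<upsilon> x) = sets (prod_space (omega_plus W))"
  by (simp add: monomial_Phi_def sum_value_def)

text \<open>The variables in \<upsilon> are fresh: no edge ends in them, so the added edges close no
  cycle, and they are not yet sources. Their targets are exactly the creators not hit by the
  contraction.\<close>

lemma epsilon_graph_particle_graph:
  assumes adm: "admissible W" and j: "j \<in> particle_terms W \<upsilon>" and \<upsilon>: "\<upsilon> \<inter> omega_plus W = {}" "\<upsilon> \<inter> omega_minus W = {}"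
  shows "epsilon_graph (particle_graph W j)"
proof -
  obtain S h where j': "j = (S, h)" by force
  have S: "S \<in> contractions W" and h: "bij_betw h (omega_plus W - snd ` S) \<upsilon>"
    using j by (auto simp: j' particle_terms_def bijections_def)
  let ?H = "(\<lambda>b. (h b, b)) ` (omega_plus W - snd ` S)"
  have eS: "finite S" "inj_on fst S" "inj_on snd S" "acyclic S" "\<And>b c. (b, c) \<in> S \<Longrightarrow> b \<noteq> c"
    using epsilon_graph_contraction[OF adm S] by (auto simp: epsilon_graph_def)
  have G: "particle_graph W j = ?H \<union> S" by (simp add: particle_graph_def j')
  have fstH: "fst ` ?H = \<upsilon>" using h by (auto simp: image_image bij_betw_def)
  have sndH: "snd ` ?H = omega_plus W - snd ` S" by (simp add: image_image)
  have "inj_on fst (?H \<union> S)"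
  proof -
    have "inj_on fst ?H" using h by (auto simp: inj_on_def bij_betw_def)
    moreover have "fst ` (?H - S) \<inter> fst ` (S - ?H) = {}"
      using fstH contraction_minus[OF S] \<upsilon> by blast
    ultimately show ?thesis using eS by (simp only: inj_on_Un simp_thms)
  qed
  moreover have "inj_on snd (?H \<union> S)"
  proof -
    have "inj_on snd ?H" by (auto simp: inj_on_def)
    moreover have "snd ` (?H - S) \<inter> snd ` (S - ?H) = {}"
      using sndH by blast
    ultimately show ?thesis using eS by (simp only: inj_on_Un simp_thms)
  qed
  moreover have "acyclic (?H \<union> S)"
  proof -
    have "Domain ?H \<inter> Range ?H = {}"
      using fstH sndH \<upsilon> unfolding Domain_fst Range_snd by blast
    then have "acyclic ?H" by (rule acyclic_Domain_Range)
    then have "wf ?H" by (intro finite_acyclic_wf) auto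
    moreover have "wf S" using eS by (intro finite_acyclic_wf)
    moreover have "Domain ?H \<inter> Range S = {}"
    proof -
      have "Domain ?H \<subseteq> \<upsilon>" using fstH by force
      moreover have "Range S \<subseteq> omega_plus W" using contraction_plus[OF S] by force
      ultimately show ?thesis using \<upsilon> by blast
    qed
    ultimately show ?thesis by (intro wf_acyclic wf_Un)
  qed
  moreover have "\<forall>(b, c)\<in>?H \<union> S. b \<noteq> c"
  proof (intro ballI, clarify del: notI)
    fix b c assume bc: "(b, c) \<in> ?H \<union> S"
    have "b \<in> \<upsilon> \<and> c \<in> omega_plus W \<or> (b, c) \<in> S"
      using bc h by (auto dest: bij_betwE)
    then show "b \<noteq> c" using eS(5) \<upsilon> by blast
  qed
  moreover have "finite (?H \<union> S)" using eS(1) by simp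
  ultimately show ?thesis
    unfolding epsilon_graph_def G by blast
qed

section \<open>Contractions of a product\<close>

lemma inj_on_converse:
  "inj_on snd r \<Longrightarrow> inj_on fst (r\<inverse>)" "inj_on fst r \<Longrightarrow> inj_on snd (r\<inverse>)"
proof -
  have "x = y" if "inj_on snd r" "x \<in> r\<inverse>" "y \<in> r\<inverse>" "fst x = fst y" for x y
    using inj_onD[OF that(1), of "prod.swap x" "prod.swap y"] that by (auto simp: prod_eq_iff)
  then show "inj_on snd r \<Longrightarrow> inj_on fst (r\<inverse>)" by (simp add: inj_onI)
  have "x = y" if "inj_on fst r" "x \<in> r\<inverse>" "y \<in> r\<inverse>" "snd x = snd y" for x y
    using inj_onD[OF that(1), of "prod.swap x" "prod.swap y"] that by (auto simp: prod_eq_iff)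
  then show "inj_on fst r \<Longrightarrow> inj_on snd (r\<inverse>)" by (simp add: inj_onI)
qed

locale two_sequences =
  fixes W1 W2 :: "'i oper list"
  assumes adm1: "admissible W1" and adm2: "admissible W2" and adm0: "admissible (adjoint_seq W1 @ W2)"
begin

abbreviation "W0 \<equiv> adjoint_seq W1 @ W2"
abbreviation "\<rho>0 \<equiv> omega_minus W0 - omega_plus W0"
abbreviation "\<rho>1 \<equiv> omega_minus W1 - omega_plus W1"
abbreviation "\<rho>2 \<equiv> omega_minus W2 - omega_plus W2"
abbreviation "indices \<equiv> omega_plus W1 \<union> omega_plus W2 \<union> (\<rho>1 \<union> \<rho>2)"

definition full_contractions :: "('i \<times> 'i) set set" where
  "full_contractions = {S \<in> contractions W0. snd ` S = omega_plus W0}"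

text \<open>
  The edges of the first factor are reversed because \<open>W\<^sub>1\<close> enters \<open>W\<^sub>0\<close> through its adjoint.
\<close>

definition glue :: "('i \<times> 'i) set \<times> ('i \<Rightarrow> 'i) \<Rightarrow> ('i \<times> 'i) set \<times> ('i \<Rightarrow> 'i) \<Rightarrow> ('i \<times> 'i) set" where
  "glue j k = (fst j)\<inverse> \<union>
    {(b, c). b \<in> omega_plus W1 - snd ` fst j \<and> c \<in> omega_plus W2 - snd ` fst k \<and> snd j b = snd k c} \<union> fst k"

text \<open>In \<open>W0\<close> the labels of \<open>omega_plus W1\<close> annihilate and those of
  \<open>omega_minus W1\<close> create, so the edges selected here are those inside the first
  factor. The converse turns them back into a contraction of \<open>W1\<close>.\<close>

definition left_part :: "('i \<times> 'i) set \<Rightarrow> ('i \<times> 'i) set" where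
  "left_part S = (S \<inter> omega_plus W1 \<times> omega_minus W1)\<inverse>"

text \<open>A created variable follows the graph of the factor that creates it, and all other
  indices are their own roots. This locates the point mass of the product of two terms.\<close>

definition joint_root ::
    "('i \<times> 'i) set \<times> ('i \<Rightarrow> 'i) \<Rightarrow> ('i \<times> 'i) set \<times> ('i \<Rightarrow> 'i) \<Rightarrow> 'i \<Rightarrow> 'i" where
  "joint_root j k v =
    (if v \<in> omega_plus W1 then chain_root (particle_graph W1 j) v
     else if v \<in> omega_plus W2 then chain_root (particle_graph W2 k) v else v)"

lemma disjoint_omega:
  "omega_minus W1 \<inter> omega_plus W2 = {}" "omega_plus W1 \<inter> omega_plus W2 = {}"
  "omega_plus W1 \<inter> omega_minus W2 = {}"
  using admissible_appendD[OF adm0] by simp_all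

lemma contractible_W0:
  "contractible W0 = (contractible W1)\<inverse> \<union> omega_plus W1 \<times> omega_plus W2 \<union> contractible W2"
  by (simp add: contractible_append contractible_adjoint_seq)

lemma full_contractionD:
  assumes "S \<in> full_contractions"
  shows "S \<subseteq> contractible W0" "inj_on fst S" "inj_on snd S"
    "fst ` S = omega_plus W1 \<union> omega_minus W2" "snd ` S = omega_minus W1 \<union> omega_plus W2"
    "epsilon_graph S"
  using assms epsilon_graph_contraction[OF adm0] by (simp_all add: full_contractions_def contractions_def)

text \<open>The annihilator of an edge stands to the left of its creator, so an annihilator from the
  second factor is never paired with a creator from the first; the other three combinations
  remain.\<close>

lemma full_contraction_cases:
  assumes "S \<in> full_contractions" "(a, b) \<in> S"
  obtains (left) "(b, a) \<in> contractible W1" "a \<in> omega_plus W1" "b \<in> omega_minus W1"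
  | (cross) "a \<in> omega_plus W1" "b \<in> omega_plus W2"
  | (right) "(a, b) \<in> contractible W2" "a \<in> omega_minus W2" "b \<in> omega_plus W2"
proof -
  have "(a, b) \<in> contractible W0"
    using full_contractionD(1)[OF assms(1)] assms(2) by blast
  then show ?thesis
    unfolding contractible_W0 using contractible_subset[of W1] contractible_subset[of W2] that by blast
qed

lemma particle_termD:
  assumes "j \<in> particle_terms W \<upsilon>"
  shows "fst j \<in> contractions W" "fst j \<subseteq> contractible W" "inj_on fst (fst j)" "inj_on snd (fst j)"
    "fst ` fst j = omega_minus W" "snd ` fst j \<subseteq> omega_plus W"
    "bij_betw (snd j) (omega_plus W - snd ` fst j) \<upsilon>"
    "snd j \<in> omega_plus W - snd ` fst j \<rightarrow>\<^sub>E \<upsilon>"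
proof -
  show *: "fst j \<in> contractions W"
    using assms by (auto simp: particle_terms_def)
  show "fst j \<subseteq> contractible W" "inj_on fst (fst j)" "inj_on snd (fst j)" "fst ` fst j = omega_minus W"
    using * by (simp_all add: contractions_def)
  show "snd ` fst j \<subseteq> omega_plus W"
    using * by (rule contraction_plus)
  have "snd j \<in> bijections (omega_plus W - snd ` fst j) \<upsilon>"
    using assms by (auto simp: particle_terms_def)
  then show "bij_betw (snd j) (omega_plus W - snd ` fst j) \<upsilon>"
    "snd j \<in> omega_plus W - snd ` fst j \<rightarrow>\<^sub>E \<upsilon>"
    by (simp_all only: bijections_def mem_Collect_eq)
qed

text \<open>The reversed edges of \<open>fst j\<close>, the cross edges and the edges of
  \<open>fst k\<close> have pairwise disjoint sources, which together exhaust
  \<open>omega_minus W0\<close>, and pairwise disjoint targets, which together exhaust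
  \<open>omega_plus W0\<close>.\<close>

lemma glue_in:
  assumes j: "j \<in> particle_terms W1 \<upsilon>" and k: "k \<in> particle_terms W2 \<upsilon>"
  shows "glue j k \<in> full_contractions" "left_part (glue j k) = fst j"
proof -
  note J = particle_termD[OF j] and K = particle_termD[OF k]
  \<comment> \<open>The cross edges form the graph of the bijection between the free creators of
    \<open>W1\<close> and those of \<open>W2\<close> that share a variable in \<upsilon>.\<close>
  define X where "X = {(b, c). b \<in> omega_plus W1 - snd ` fst j \<and> c \<in> omega_plus W2 - snd ` fst k \<and> snd j b = snd k c}"
  have glue: "glue j k = (fst j)\<inverse> \<union> X \<union> fst k"
    by (simp add: glue_def X_def)
  have fsts: "fst ` ((fst j)\<inverse>) = snd ` fst j" "snd ` ((fst j)\<inverse>) = omega_minus W1"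
    unfolding J(5)[symmetric] by force+
  have fstX: "fst ` X = omega_plus W1 - snd ` fst j"
  proof
    show "omega_plus W1 - snd ` fst j \<subseteq> fst ` X"
    proof
      fix b assume b: "b \<in> omega_plus W1 - snd ` fst j"
      then have "snd j b \<in> snd k ` (omega_plus W2 - snd ` fst k)"
        using J(7) K(7) unfolding bij_betw_def by blast
      then obtain c where "c \<in> omega_plus W2 - snd ` fst k" "snd j b = snd k c" by blast
      then have "(b, c) \<in> X" using b by (simp add: X_def)
      then show "b \<in> fst ` X" by force
    qed
    show "fst ` X \<subseteq> omega_plus W1 - snd ` fst j"
      by (rule image_subsetI) (simp add: X_def case_prod_beta)
  qed
  have sndX: "snd ` X = omega_plus W2 - snd ` fst k"
  proof
    show "omega_plus W2 - snd ` fst k \<subseteq> snd ` X"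
    proof
      fix c assume c: "c \<in> omega_plus W2 - snd ` fst k"
      then have "snd k c \<in> snd j ` (omega_plus W1 - snd ` fst j)"
        using J(7) K(7) unfolding bij_betw_def by blast
      then obtain b where "b \<in> omega_plus W1 - snd ` fst j" "snd k c = snd j b" by blast
      then have "(b, c) \<in> X" using c by (simp add: X_def)
      then show "c \<in> snd ` X" by force
    qed
    show "snd ` X \<subseteq> omega_plus W2 - snd ` fst k"
      by (rule image_subsetI) (simp add: X_def case_prod_beta)
  qed
  have inj: "inj_on (snd j) (omega_plus W1 - snd ` fst j)" "inj_on (snd k) (omega_plus W2 - snd ` fst k)"
    using J(7) K(7) by (simp_all only: bij_betw_def)
  have memX: "fst x \<in> omega_plus W1 - snd ` fst j" "snd x \<in> omega_plus W2 - snd ` fst k"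
    "snd j (fst x) = snd k (snd x)" if "x \<in> X" for x
    using that by (simp_all add: X_def case_prod_beta)
  have injX: "inj_on fst X" "inj_on snd X"
  proof -
    show "inj_on fst X"
    proof (rule inj_onI)
      fix x y assume xy: "x \<in> X" "y \<in> X" "fst x = fst y"
      then have "snd k (snd x) = snd k (snd y)" using memX(3)[of x] memX(3)[of y] by simp
      then have "snd x = snd y" using inj_onD[OF inj(2) _ memX(2) memX(2)] xy by blast
      then show "x = y" using xy by (simp add: prod_eq_iff)
    qed
    show "inj_on snd X"
    proof (rule inj_onI)
      fix x y assume xy: "x \<in> X" "y \<in> X" "snd x = snd y"
      then have "snd j (fst x) = snd j (fst y)" using memX(3)[of x] memX(3)[of y] by simp
      then have "fst x = fst y" using inj_onD[OF inj(1) _ memX(1) memX(1)] xy by blast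
      then show "x = y" using xy by (simp add: prod_eq_iff)
    qed
  qed
  have injJ: "inj_on fst ((fst j)\<inverse>)" "inj_on snd ((fst j)\<inverse>)"
    using J(3,4) by (simp_all only: inj_on_converse)
  have "inj_on fst (glue j k)"
  proof -
    have "fst ` ((fst j)\<inverse> - X) \<inter> fst ` (X - (fst j)\<inverse>) = {}"
      using fsts fstX by blast
    then have "inj_on fst ((fst j)\<inverse> \<union> X)"
      using injX injJ by (simp only: inj_on_Un simp_thms)
    moreover have "fst ` ((fst j)\<inverse> \<union> X) \<inter> fst ` (fst k) = {}"
      unfolding image_Un fsts fstX K(5) using J(6) disjoint_omega by blast
    then have "fst ` ((fst j)\<inverse> \<union> X - fst k) \<inter> fst ` (fst k - ((fst j)\<inverse> \<union> X)) = {}"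
      by blast
    ultimately show ?thesis
      unfolding glue using K(3) by (simp only: inj_on_Un[of _ "_ \<union> _"] simp_thms)
  qed
  moreover have "inj_on snd (glue j k)"
  proof -
    have "snd ` ((fst j)\<inverse>) \<inter> snd ` X = {}"
      unfolding fsts sndX using disjoint_omega by blast
    then have "snd ` ((fst j)\<inverse> - X) \<inter> snd ` (X - (fst j)\<inverse>) = {}" by blast
    then have "inj_on snd ((fst j)\<inverse> \<union> X)"
      using injX injJ by (simp only: inj_on_Un simp_thms)
    moreover have "snd ` ((fst j)\<inverse> \<union> X) \<inter> snd ` (fst k) = {}"
      unfolding image_Un fsts sndX using K(6) disjoint_omega by blast
    then have "snd ` ((fst j)\<inverse> \<union> X - fst k) \<inter> snd ` (fst k - ((fst j)\<inverse> \<union> X)) = {}"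
      by blast
    ultimately show ?thesis
      unfolding glue using K(4) by (simp only: inj_on_Un[of _ "_ \<union> _"] simp_thms)
  qed
  moreover have "glue j k \<subseteq> contractible W0"
    unfolding glue contractible_W0 using J(2) K(2) by (auto simp: X_def)
  moreover have "fst ` glue j k = omega_minus W0"
    unfolding glue image_Un fsts fstX K(5) using J(6) by (simp only: omega_minus_simps omega_adjoint_seq) blast
  moreover have "snd ` glue j k = omega_plus W0"
    unfolding glue image_Un fsts sndX using K(6) by (simp only: omega_plus_simps omega_adjoint_seq) blast
  ultimately show "glue j k \<in> full_contractions"
    by (simp only: full_contractions_def contractions_def mem_Collect_eq simp_thms)
  have "glue j k \<inter> omega_plus W1 \<times> omega_minus W1 = (fst j)\<inverse>"
  proof
    show "(fst j)\<inverse> \<subseteq> glue j k \<inter> omega_plus W1 \<times> omega_minus W1"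
      unfolding glue using J(2) contractible_subset[of W1] by blast
    have "fst k \<inter> omega_plus W1 \<times> omega_minus W1 = {}"
      using K(2) contractible_subset[of W2] disjoint_omega by blast
    moreover have "X \<inter> omega_plus W1 \<times> omega_minus W1 = {}"
      using disjoint_omega by (auto simp: X_def)
    ultimately show "glue j k \<inter> omega_plus W1 \<times> omega_minus W1 \<subseteq> (fst j)\<inverse>"
      unfolding glue by blast
  qed
  then show "left_part (glue j k) = fst j"
    by (simp add: left_part_def)
qed

text \<open>Labels in \<open>omega_minus W1\<close> are not in \<open>omega_plus W2\<close>, so the
  edge ending in such a label must start in the first factor. Hence every annihilator of
  \<open>W1\<close> stays paired.\<close>

lemma left_part_in:
  assumes S: "S \<in> full_contractions"
  shows "left_part S \<in> contractions W1"
proof -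
  note D = full_contractionD[OF S]
  have "left_part S \<subseteq> contractible W1"
  proof
    fix x assume "x \<in> left_part S"
    then obtain a b where x: "x = (b, a)" "(a, b) \<in> S" "a \<in> omega_plus W1" "b \<in> omega_minus W1"
      by (auto simp: left_part_def)
    from S x(2) show "x \<in> contractible W1"
      by (cases rule: full_contraction_cases) (use x disjoint_omega in auto)
  qed
  moreover have "inj_on fst (left_part S)" "inj_on snd (left_part S)"
    unfolding left_part_def
    using inj_on_subset[OF D(2), of "S \<inter> omega_plus W1 \<times> omega_minus W1"]
      inj_on_subset[OF D(3), of "S \<inter> omega_plus W1 \<times> omega_minus W1"]
    by (simp_all only: inj_on_converse Int_lower1)
  moreover have "omega_minus W1 \<subseteq> fst ` left_part S"
  proof
    fix b assume b: "b \<in> omega_minus W1"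
    then have "b \<in> snd ` S" using D(5) by simp
    then obtain a where ab: "(a, b) \<in> S" by force
    from S ab have "a \<in> omega_plus W1"
      by (cases rule: full_contraction_cases) (use b disjoint_omega in auto)
    then have "(b, a) \<in> left_part S"
      using ab b by (simp add: left_part_def)
    then show "b \<in> fst ` left_part S" by force
  qed
  moreover have "fst ` left_part S \<subseteq> omega_minus W1"
    by (auto simp: left_part_def)
  ultimately show ?thesis
    unfolding contractions_def by blast
qed

text \<open>Once \<open>j\<close> is fixed, the elements of \<upsilon> serve as names for the free
  creators of \<open>W1\<close>. Assigning the free creators of \<open>W2\<close> to \<upsilon> is
  then the same as choosing the cross edges.\<close>

lemma bij_betw_glue:
  assumes j: "j \<in> particle_terms W1 \<upsilon>"
  shows "bij_betw (glue j) (particle_terms W2 \<upsilon>) {S \<in> full_contractions. left_part S = fst j}"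
proof (rule bij_betw_imageI)
  note J = particle_termD[OF j]
  show "inj_on (glue j) (particle_terms W2 \<upsilon>)"
  proof (rule inj_onI)
    \<comment> \<open>The edges inside the second factor recover \<open>fst k\<close>; the cross
      edges then determine \<open>snd k\<close>.\<close>
    have restr: "glue j k \<inter> omega_minus W2 \<times> omega_plus W2 = fst k" if k: "k \<in> particle_terms W2 \<upsilon>" for k
    proof
      note K = particle_termD[OF k]
      show "fst k \<subseteq> glue j k \<inter> omega_minus W2 \<times> omega_plus W2"
        using K(2) contractible_subset[of W2] by (auto simp: glue_def)
      have "(fst j)\<inverse> \<inter> omega_minus W2 \<times> omega_plus W2 = {}"
        using J(2) contractible_subset[of W1] disjoint_omega by blast
      then show "glue j k \<inter> omega_minus W2 \<times> omega_plus W2 \<subseteq> fst k"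
        unfolding glue_def using disjoint_omega by blast
    qed
    fix k l assume k: "k \<in> particle_terms W2 \<upsilon>" and l: "l \<in> particle_terms W2 \<upsilon>" and eq: "glue j k = glue j l"
    note K = particle_termD[OF k] and L = particle_termD[OF l]
    have fst: "fst k = fst l"
      using restr[OF k] restr[OF l] eq by simp
    have kl: "snd k \<in> omega_plus W2 - snd ` fst k \<rightarrow>\<^sub>E \<upsilon>" "snd l \<in> omega_plus W2 - snd ` fst k \<rightarrow>\<^sub>E \<upsilon>"
      using K(8) L(8) by (simp_all only: fst)
    have "snd k = snd l"
    proof (rule PiE_ext[OF kl])
      fix c assume c: "c \<in> omega_plus W2 - snd ` fst k"
      then have "snd k c \<in> snd j ` (omega_plus W1 - snd ` fst j)"
        using J(7) K(7) unfolding bij_betw_def by blast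
      then obtain b where b: "b \<in> omega_plus W1 - snd ` fst j" "snd k c = snd j b" by blast
      then have "(b, c) \<in> glue j l" using c eq by (auto simp: glue_def)
      moreover have "(b, c) \<notin> (fst j)\<inverse>"
        using b by force
      moreover have "(b, c) \<notin> fst l"
        using c fst by force
      ultimately have "snd j b = snd l c" by (auto simp: glue_def)
      then show "snd k c = snd l c" using b by simp
    qed
    then show "k = l" using fst by (simp add: prod_eq_iff)
  qed
  show "glue j ` particle_terms W2 \<upsilon> = {S \<in> full_contractions. left_part S = fst j}"
  proof
    show "glue j ` particle_terms W2 \<upsilon> \<subseteq> {S \<in> full_contractions. left_part S = fst j}"
      using glue_in[OF j] by blast
    show "{S \<in> full_contractions. left_part S = fst j} \<subseteq> glue j ` particle_terms W2 \<upsilon>"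
    proof
      fix S assume "S \<in> {S \<in> full_contractions. left_part S = fst j}"
      then have S: "S \<in> full_contractions" and left: "left_part S = fst j" by auto
      note D = full_contractionD[OF S]
      define S2 where "S2 = S \<inter> omega_minus W2 \<times> omega_plus W2"
      \<comment> \<open>\<open>pred c\<close> is the source of the unique edge that ends in
        \<open>c\<close>.\<close>
      define pred where "pred c = (THE b. (b, c) \<in> S)" for c
      define \<sigma>1 where "\<sigma>1 = omega_plus W1 - snd ` fst j"
      define \<sigma>2 where "\<sigma>2 = omega_plus W2 - snd ` S2"
      have fst_inj: "c = c'" if "(b, c) \<in> S" "(b, c') \<in> S" for b c c'
        using inj_onD[OF D(2) _ that] by simp
      have snd_inj: "b = b'" if "(b, c) \<in> S" "(b', c) \<in> S" for b b' c
        using inj_onD[OF D(3) _ that] by simp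
      have pred: "pred c = b" if "(b, c) \<in> S" for b c
        unfolding pred_def using that snd_inj by blast
      have S2: "S2 \<in> contractions W2"
      proof -
        have "S2 \<subseteq> contractible W2"
        proof
          fix x assume "x \<in> S2"
          then obtain a b where x: "x = (a, b)" "(a, b) \<in> S" "a \<in> omega_minus W2" "b \<in> omega_plus W2"
            by (auto simp: S2_def)
          from S x(2) show "x \<in> contractible W2"
            by (cases rule: full_contraction_cases) (use x disjoint_omega in auto)
        qed
        moreover have "inj_on fst S2" "inj_on snd S2"
          using D(2,3) by (auto simp: S2_def intro: inj_on_subset)
        moreover have "omega_minus W2 \<subseteq> fst ` S2"
        proof
          fix a assume a: "a \<in> omega_minus W2"
          then have "a \<in> fst ` S" using D(4) by simp
          then obtain b where ab: "(a, b) \<in> S" by force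
          from S ab have "b \<in> omega_plus W2"
            by (cases rule: full_contraction_cases) (use a disjoint_omega in auto)
          then have "(a, b) \<in> S2" using a ab by (simp add: S2_def)
          then show "a \<in> fst ` S2" by force
        qed
        moreover have "fst ` S2 \<subseteq> omega_minus W2" by (auto simp: S2_def)
        ultimately show ?thesis unfolding contractions_def by blast
      qed
      \<comment> \<open>A creator of \<open>W2\<close> not hit from inside \<open>W2\<close> must be
        hit from \<open>W1\<close>. Its source is a free creator of \<open>W1\<close>, because the
        only edge leaving that source already goes to \<open>c\<close>.\<close>
      have cross1: "\<exists>b. (b, c) \<in> S \<and> b \<in> \<sigma>1" if c: "c \<in> \<sigma>2" for c
      proof -
        have "c \<in> snd ` S" using c D(5) by (auto simp: \<sigma>2_def)
        then obtain b where b: "(b, c) \<in> S" by force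
        have "c \<in> omega_plus W2" using c by (simp add: \<sigma>2_def)
        have "b \<notin> omega_minus W2"
        proof
          assume "b \<in> omega_minus W2"
          then have "(b, c) \<in> S2" using b c by (simp add: S2_def \<sigma>2_def)
          then show False using c by (force simp: \<sigma>2_def)
        qed
        from S b have "b \<in> omega_plus W1"
          by (cases rule: full_contraction_cases) (use \<open>b \<notin> omega_minus W2\<close> in auto)
        moreover have "b \<notin> snd ` fst j"
        proof
          assume "b \<in> snd ` fst j"
          then obtain d where "(d, b) \<in> left_part S" unfolding left by force
          then have "(b, d) \<in> S" "d \<in> omega_minus W1" by (auto simp: left_part_def)
          then show False using fst_inj[OF b] \<open>c \<in> omega_plus W2\<close> disjoint_omega by blast
        qed
        ultimately show ?thesis using b by (auto simp: \<sigma>1_def)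
      qed
      have cross2: "\<exists>c. (b, c) \<in> S \<and> c \<in> \<sigma>2" if b: "b \<in> \<sigma>1" for b
      proof -
        have "b \<in> fst ` S" using b D(4) by (auto simp: \<sigma>1_def)
        then obtain c where c: "(b, c) \<in> S" by force
        have "b \<in> omega_plus W1" using b by (simp add: \<sigma>1_def)
        have "c \<notin> omega_minus W1"
        proof
          assume "c \<in> omega_minus W1"
          then have "(c, b) \<in> left_part S" using c \<open>b \<in> omega_plus W1\<close> by (simp add: left_part_def)
          then show False using b unfolding left by (force simp: \<sigma>1_def)
        qed
        from S c have "c \<in> omega_plus W2"
          by (cases rule: full_contraction_cases) (use \<open>c \<notin> omega_minus W1\<close> in auto)
        moreover have "c \<notin> snd ` S2"
        proof
          assume "c \<in> snd ` S2"
          then obtain d where "(d, c) \<in> S" "d \<in> omega_minus W2" by (auto simp: S2_def)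
          then show False using snd_inj[OF c] \<open>b \<in> omega_plus W1\<close> disjoint_omega by blast
        qed
        ultimately show ?thesis using c by (auto simp: \<sigma>2_def)
      qed
      have bij: "bij_betw pred \<sigma>2 \<sigma>1"
      proof (rule bij_betw_imageI)
        show "inj_on pred \<sigma>2"
        proof (rule inj_onI)
          fix c c' assume c: "c \<in> \<sigma>2" "c' \<in> \<sigma>2" "pred c = pred c'"
          obtain b where b: "(b, c) \<in> S" using cross1[OF c(1)] by blast
          obtain b' where b': "(b', c') \<in> S" using cross1[OF c(2)] by blast
          have "b = b'" using pred[OF b] pred[OF b'] c(3) by simp
          then show "c = c'" using fst_inj b b' by blast
        qed
        show "pred ` \<sigma>2 = \<sigma>1"
        proof
          show "pred ` \<sigma>2 \<subseteq> \<sigma>1" using cross1 pred by blast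
          show "\<sigma>1 \<subseteq> pred ` \<sigma>2"
          proof
            fix b assume "b \<in> \<sigma>1"
            then obtain c where "(b, c) \<in> S" "c \<in> \<sigma>2" using cross2 by blast
            then show "b \<in> pred ` \<sigma>2" using pred[of b c] by blast
          qed
        qed
      qed
      \<comment> \<open>Each free creator of \<open>W2\<close> is assigned the variable of its
        partner in \<open>W1\<close>.\<close>
      define h where "h = (\<lambda>c\<in>\<sigma>2. snd j (pred c))"
      have h: "bij_betw h \<sigma>2 \<upsilon>"
      proof -
        have "bij_betw (snd j \<circ> pred) \<sigma>2 \<upsilon>"
          using bij J(7) unfolding \<sigma>1_def by (rule bij_betw_trans)
        then show ?thesis by (subst bij_betw_cong[of _ _ "snd j \<circ> pred"]) (auto simp: h_def)
      qed
      then have "h \<in> bijections \<sigma>2 \<upsilon>"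
        using bij_betwE[OF h] by (auto simp: bijections_def h_def)
      then have k: "(S2, h) \<in> particle_terms W2 \<upsilon>"
        using S2 by (simp add: particle_terms_def \<sigma>2_def)
      have "glue j (S2, h) = S"
      proof
        have "(b, c) \<in> S" if "b \<in> \<sigma>1" "c \<in> \<sigma>2" "snd j b = h c" for b c
        proof -
          obtain b' where b': "(b', c) \<in> S" "b' \<in> \<sigma>1" using cross1 \<open>c \<in> \<sigma>2\<close> by blast
          then have "snd j b = snd j b'" using that pred by (simp add: h_def)
          then have "b = b'" using J(7) that(1) b'(2) unfolding \<sigma>1_def bij_betw_def inj_on_def by blast
          then show ?thesis using b' by simp
        qed
        moreover have "(fst j)\<inverse> \<subseteq> S" unfolding left[symmetric] by (auto simp: left_part_def)
        moreover have "S2 \<subseteq> S" by (auto simp: S2_def)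
        ultimately show "glue j (S2, h) \<subseteq> S"
          unfolding glue_def fst_conv snd_conv \<sigma>1_def[symmetric] \<sigma>2_def[symmetric] by blast
        show "S \<subseteq> glue j (S2, h)"
        proof safe
          fix a b assume ab: "(a, b) \<in> S"
          show "(a, b) \<in> glue j (S2, h)"
          proof (cases "b \<in> \<sigma>2")
            case True
            then obtain a' where "(a', b) \<in> S" "a' \<in> \<sigma>1" using cross1 by blast
            then have "a \<in> \<sigma>1" using snd_inj ab by blast
            moreover have "snd j a = h b" using True pred[OF ab] by (simp add: h_def)
            ultimately show ?thesis
              unfolding glue_def fst_conv snd_conv \<sigma>1_def[symmetric] \<sigma>2_def[symmetric] using True by blast
          next
            case False
            have "(a, b) \<in> (fst j)\<inverse> \<or> (a, b) \<in> S2"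
            proof (cases "b \<in> omega_plus W2")
              case True
              then have "b \<in> snd ` S2" using False by (simp add: \<sigma>2_def)
              then obtain a' where a': "(a', b) \<in> S2" by force
              then have "a' = a" using snd_inj[OF ab, of a'] by (auto simp: S2_def)
              then show ?thesis using a' by simp
            next
              case False
              from S ab show ?thesis
              proof (cases rule: full_contraction_cases)
                case left
                then show ?thesis using ab unfolding \<open>left_part S = fst j\<close>[symmetric] by (simp add: left_part_def)
              qed (use False in auto)
            qed
            then show ?thesis by (auto simp: glue_def)
          qed
        qed
      qed
      then show "S \<in> glue j ` particle_terms W2 \<upsilon>" using k by blast
    qed
  qed
qed

section \<open>Multiplicities of full contractions and comparison of roots\<close>

lemma finite_full_contractions [simp]: "finite full_contractions"
  by (simp add: full_contractions_def)

text \<open>For each contraction \<open>S1\<close> of \<open>W1\<close>, every assignment of its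
  free creators to \<upsilon> yields the same sum, over the full contractions with left part
  \<open>S1\<close>. The number of assignments is the factorial.\<close>

lemma sum_glue:
  fixes f :: "('i \<times> 'i) set \<Rightarrow> 'b::comm_semiring_1"
  assumes \<upsilon>: "finite \<upsilon>" "card \<upsilon> = card (omega_plus W1) - card (omega_minus W1)"
  shows "(\<Sum>j\<in>particle_terms W1 \<upsilon>. \<Sum>k\<in>particle_terms W2 \<upsilon>. f (glue j k)) =
    of_nat (fact (card \<upsilon>)) * (\<Sum>S\<in>full_contractions. f S)"
proof -
  let ?X = "\<lambda>S1. \<Sum>S | S \<in> full_contractions \<and> left_part S = S1. f S"
  have "(\<Sum>j\<in>particle_terms W1 \<upsilon>. \<Sum>k\<in>particle_terms W2 \<upsilon>. f (glue j k)) =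
      (\<Sum>j\<in>particle_terms W1 \<upsilon>. ?X (fst j))"
    by (intro sum.cong refl sum.reindex_bij_betw bij_betw_glue)
  also have "\<dots> = (\<Sum>S1\<in>contractions W1. \<Sum>h\<in>bijections (omega_plus W1 - snd ` S1) \<upsilon>. ?X S1)"
    unfolding particle_terms_def using \<upsilon> by (subst sum.Sigma) (auto simp: case_prod_beta)
  also have "\<dots> = (\<Sum>S1\<in>contractions W1. of_nat (fact (card \<upsilon>)) * ?X S1)"
  proof (rule sum.cong[OF refl])
    fix S1 assume "S1 \<in> contractions W1"
    then have "card (bijections (omega_plus W1 - snd ` S1) \<upsilon>) = fact (card \<upsilon>)"
      using card_contraction_complement \<upsilon> by (intro card_bijections) auto
    then show "(\<Sum>h\<in>bijections (omega_plus W1 - snd ` S1) \<upsilon>. ?X S1) = of_nat (fact (card \<upsilon>)) * ?X S1"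
      by simp
  qed
  also have "\<dots> = of_nat (fact (card \<upsilon>)) * (\<Sum>S1\<in>contractions W1. ?X S1)"
    by (simp only: sum_distrib_left)
  also have "(\<Sum>S1\<in>contractions W1. ?X S1) = (\<Sum>S\<in>full_contractions. f S)"
    using left_part_in by (intro sum.group) auto
  finally show ?thesis .
qed

text \<open>The two particle graphs together and the glued graph connect the indices in the same
  way: a cross edge bypasses a variable of \<upsilon>, and reversing an edge changes no component.
  In each component one root lies in \<open>\<rho>0\<close> and one in
  \<open>\<upsilon> \<union> (\<rho>1 \<union> \<rho>2)\<close>, and \<open>joint_root\<close>
  matches them.\<close>

lemma joint_root_bij:
  assumes j: "j \<in> particle_terms W1 \<upsilon>" and k: "k \<in> particle_terms W2 \<upsilon>" and \<upsilon>: "\<upsilon> \<inter> indices = {}"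
  shows "bij_betw (joint_root j k) \<rho>0 (\<upsilon> \<union> (\<rho>1 \<union> \<rho>2))"
    and "\<And>v. v \<in> indices \<Longrightarrow> joint_root j k v = joint_root j k (chain_root (glue j k) v)"
    and "\<And>v. v \<in> indices \<Longrightarrow> chain_root (glue j k) v \<in> \<rho>0"
    and "\<And>v. v \<in> indices \<Longrightarrow> joint_root j k v \<in> \<upsilon> \<union> (\<rho>1 \<union> \<rho>2)"
proof -
  note J = particle_termD[OF j] and K = particle_termD[OF k]
  let ?G1 = "particle_graph W1 j" and ?G2 = "particle_graph W2 k" and ?S = "glue j k"
  let ?f = "joint_root j k" and ?f' = "chain_root ?S"
  have S: "?S \<in> full_contractions" by (rule glue_in[OF j k])
  note D = full_contractionD[OF S]
  have G1: "epsilon_graph ?G1"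
    using \<upsilon> by (intro epsilon_graph_particle_graph[OF adm1 j]) auto
  have G2: "epsilon_graph ?G2"
    using \<upsilon> by (intro epsilon_graph_particle_graph[OF adm2 k]) auto
  have f1: "?f v = chain_root ?G1 v" if "v \<in> omega_plus W1 \<union> omega_minus W1" for v
    using that disjoint_omega chain_root_id[of v ?G1]
    unfolding joint_root_def S_plus_particle_graph[OF j] by auto
  have f2: "?f v = chain_root ?G2 v" if "v \<in> omega_plus W2 \<union> omega_minus W2" for v
    using that disjoint_omega chain_root_id[of v ?G2]
    unfolding joint_root_def S_plus_particle_graph[OF k] by auto
  have root1: "chain_root ?G1 b = snd j b" if b: "b \<in> omega_plus W1 - snd ` fst j" for b
  proof -
    have "(snd j b, b) \<in> ?G1" using b by (auto simp: particle_graph_def)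
    then have "chain_root ?G1 b = chain_root ?G1 (snd j b)" by (rule chain_root_edge[OF G1])
    also have "\<dots> = snd j b"
      using bij_betwE[OF J(7)] b \<upsilon> by (intro chain_root_id) (auto simp: S_plus_particle_graph[OF j])
    finally show ?thesis .
  qed
  have root2: "chain_root ?G2 b = snd k b" if b: "b \<in> omega_plus W2 - snd ` fst k" for b
  proof -
    have "(snd k b, b) \<in> ?G2" using b by (auto simp: particle_graph_def)
    then have "chain_root ?G2 b = chain_root ?G2 (snd k b)" by (rule chain_root_edge[OF G2])
    also have "\<dots> = snd k b"
      using bij_betwE[OF K(7)] b \<upsilon> by (intro chain_root_id) (auto simp: S_plus_particle_graph[OF k])
    finally show ?thesis .
  qed
  \<comment> \<open>The joint root is constant along glued edges; the ends of a cross edge hang on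
    the same variable in \<upsilon>.\<close>
  have edge_f: "?f b = ?f a" if ab: "(a, b) \<in> ?S" for a b
  proof -
    consider "(b, a) \<in> fst j" | "a \<in> omega_plus W1 - snd ` fst j" "b \<in> omega_plus W2 - snd ` fst k" "snd j a = snd k b"
      | "(a, b) \<in> fst k"
      using ab by (auto simp: glue_def)
    then show ?thesis
    proof cases
      case 1
      then have "a \<in> omega_plus W1" "b \<in> omega_minus W1"
        using J(2) contractible_subset[of W1] by auto
      moreover have "(b, a) \<in> ?G1" using 1 by (simp add: particle_graph_def)
      ultimately show ?thesis
        using chain_root_edge[OF G1, of b a] f1[of a] f1[of b] by simp
    next
      case 2
      then show ?thesis using f1[of a] f2[of b] root1[of a] root2[of b] by simp
    next
      case 3
      then have "a \<in> omega_minus W2" "b \<in> omega_plus W2"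
        using K(2) contractible_subset[of W2] by auto
      moreover have "(a, b) \<in> ?G2" using 3 by (simp add: particle_graph_def)
      ultimately show ?thesis
        using chain_root_edge[OF G2, of a b] f2[of a] f2[of b] by simp
    qed
  qed
  show ff': "?f v = ?f (?f' v)" for v
    using chain_root_invariant[OF D(6), of ?f v] edge_f by simp
  \<comment> \<open>A variable in \<upsilon> is replaced by the free creator of \<open>W1\<close>
    hanging on it, and everything else is kept. Through \<open>e\<close> the root map of the glued
    graph also makes sense on \<upsilon>.\<close>
  define e where "e r = (if r \<in> \<upsilon> then inv_into (omega_plus W1 - snd ` fst j) (snd j) r else r)" for r
  have e_inv: "e (snd j b) = b" if "b \<in> omega_plus W1 - snd ` fst j" for b
    using that bij_betwE[OF J(7)] bij_betw_inv_into_left[OF J(7)] by (simp add: e_def)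
  have e_id: "e v = v" if "v \<in> indices" for v
    using that \<upsilon> by (auto simp: e_def)
  have sub: "omega_plus W1 \<union> omega_minus W1 \<subseteq> indices" "omega_plus W2 \<union> omega_minus W2 \<subseteq> indices"
    by auto
  have edge1: "?f' (e b) = ?f' (e a)" if ab: "(a, b) \<in> ?G1" for a b
  proof -
    consider "(a, b) \<in> fst j" | "b \<in> omega_plus W1 - snd ` fst j" "a = snd j b"
      using ab by (auto simp: particle_graph_def)
    then show ?thesis
    proof cases
      case 1
      then have "b \<in> omega_plus W1" "a \<in> omega_minus W1"
        using J(2) contractible_subset[of W1] by auto
      then have "e a = a" "e b = b" using e_id sub by blast+
      moreover have "(b, a) \<in> ?S" using 1 by (simp add: glue_def)
      ultimately show ?thesis using chain_root_edge[OF D(6), of b a] by simp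
    next
      case 2
      then have "e b = b" using e_id sub by blast
      then show ?thesis using 2 e_inv by simp
    qed
  qed
  \<comment> \<open>Since \<open>e\<close> selects a creator of \<open>W1\<close>, an edge from
    \<upsilon> to a creator \<open>b\<close> of \<open>W2\<close> becomes the cross edge that ends
    in \<open>b\<close>.\<close>
  have edge2: "?f' (e b) = ?f' (e a)" if ab: "(a, b) \<in> ?G2" for a b
  proof -
    consider "(a, b) \<in> fst k" | "b \<in> omega_plus W2 - snd ` fst k" "a = snd k b"
      using ab by (auto simp: particle_graph_def)
    then show ?thesis
    proof cases
      case 1
      then have "b \<in> omega_plus W2" "a \<in> omega_minus W2"
        using K(2) contractible_subset[of W2] by auto
      then have "e a = a" "e b = b" using e_id sub by blast+
      moreover have "(a, b) \<in> ?S" using 1 by (simp add: glue_def)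
      ultimately show ?thesis using chain_root_edge[OF D(6), of a b] by simp
    next
      case 2
      then have "snd k b \<in> snd j ` (omega_plus W1 - snd ` fst j)"
        using J(7) K(7) unfolding bij_betw_def by blast
      then obtain c where c: "c \<in> omega_plus W1 - snd ` fst j" "snd k b = snd j c" by blast
      then have "(c, b) \<in> ?S" using 2 by (auto simp: glue_def)
      moreover have "e a = c" using 2 c e_inv by simp
      moreover have "e b = b" using 2 e_id sub by blast
      ultimately show ?thesis using chain_root_edge[OF D(6), of c b] by simp
    qed
  qed
  \<comment> \<open>Passing to the joint root and returning through \<open>e\<close> stays in the
    same component of the glued graph.\<close>
  have f'e: "?f' v = ?f' (e (?f v))" if v: "v \<in> indices" for v
  proof (cases "v \<in> omega_plus W1 \<union> omega_minus W1")
    case True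
    then show ?thesis
      using chain_root_invariant[OF G1, of "\<lambda>v. ?f' (e v)" v] edge1 f1[OF True] e_id[OF v] by simp
  next
    case False
    then have True: "v \<in> omega_plus W2 \<union> omega_minus W2" using v by blast
    then show ?thesis
      using chain_root_invariant[OF G2, of "\<lambda>v. ?f' (e v)" v] edge2 f2[OF True] e_id[OF v] by simp
  qed
  show f'_in: "?f' v \<in> \<rho>0" if v: "v \<in> indices" for v
  proof (cases "v \<in> S_plus ?S")
    case True
    then show ?thesis
      using chain_root_in[OF D(6) True] unfolding D(4,5) by simp
  next
    case False
    then show ?thesis
      using v chain_root_id[OF False] unfolding D(5) by auto
  qed
  show f_in: "?f v \<in> \<upsilon> \<union> (\<rho>1 \<union> \<rho>2)" if v: "v \<in> indices" for v
  proof -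
    consider "v \<in> omega_plus W1" | "v \<in> omega_plus W2" | "v \<notin> omega_plus W1" "v \<notin> omega_plus W2" by blast
    then show ?thesis
    proof cases
      case 1
      then have "chain_root ?G1 v \<in> S_minus ?G1 - S_plus ?G1"
        by (intro chain_root_in G1) (simp add: S_plus_particle_graph[OF j])
      then show ?thesis
        using f1[of v] 1 unfolding S_plus_particle_graph[OF j] S_minus_particle_graph[OF j] by auto
    next
      case 2
      then have "chain_root ?G2 v \<in> S_minus ?G2 - S_plus ?G2"
        by (intro chain_root_in G2) (simp add: S_plus_particle_graph[OF k])
      then show ?thesis
        using f2[of v] 2 unfolding S_plus_particle_graph[OF k] S_minus_particle_graph[OF k] by auto
    next
      case 3
      then show ?thesis using v by (auto simp: joint_root_def)
    qed
  qed
  have e_in: "e r \<in> indices \<and> ?f (e r) = r" if r: "r \<in> \<upsilon> \<union> (\<rho>1 \<union> \<rho>2)" for r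
  proof (cases "r \<in> \<upsilon>")
    case True
    then obtain b where b: "b \<in> omega_plus W1 - snd ` fst j" "r = snd j b"
      using J(7) unfolding bij_betw_def by blast
    then show ?thesis using e_inv[OF b(1)] root1[OF b(1)] f1[of b] by simp
  next
    case False
    then have r: "r \<in> \<rho>1 \<union> \<rho>2" using r by blast
    then have "r \<notin> omega_plus W1" "r \<notin> omega_plus W2" using disjoint_omega by auto
    then show ?thesis using r e_id[of r] by (simp add: joint_root_def)
  qed
  have \<rho>0: "\<rho>0 \<subseteq> indices" by auto
  show "bij_betw ?f \<rho>0 (\<upsilon> \<union> (\<rho>1 \<union> \<rho>2))"
  proof (rule bij_betw_byWitness[where f' = "?f' \<circ> e"])
    show "\<forall>v\<in>\<rho>0. (?f' \<circ> e) (?f v) = v"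
    proof
      fix v assume v: "v \<in> \<rho>0"
      then have "v \<notin> S_plus ?S" unfolding D(5) by simp
      then have "?f' v = v" by (rule chain_root_id)
      moreover have "v \<in> indices" using v \<rho>0 by blast
      ultimately show "(?f' \<circ> e) (?f v) = v" using f'e by simp
    qed
    show "\<forall>r\<in>\<upsilon> \<union> (\<rho>1 \<union> \<rho>2). ?f ((?f' \<circ> e) r) = r"
      using e_in ff' by (metis comp_apply)
    show "?f ` \<rho>0 \<subseteq> \<upsilon> \<union> (\<rho>1 \<union> \<rho>2)" using f_in \<rho>0 by blast
    show "(?f' \<circ> e) ` (\<upsilon> \<union> (\<rho>1 \<union> \<rho>2)) \<subseteq> \<rho>0" using f'_in e_in by auto
  qed
qed

end

section \<open>Powers of \<open>\<lambda>\<close>\<close>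

lemma measure_on_cong:
  "(\<And>A. A \<in> sets (prod_space \<pi>) \<Longrightarrow> \<mu> A = \<nu> A) \<Longrightarrow> measure_on \<pi> \<mu> = measure_on \<pi> \<nu>"
  unfolding measure_on_def by (rule measure_of_eq) (auto simp: sets.space_closed sets.sigma_sets_eq)

lemma sets_lambda_pow:
  "sets lam = sets borel \<Longrightarrow> sets (lambda_pow lam R) = sets (prod_space R)"
  unfolding lambda_pow_def prod_space_def by (intro sets_PiM_cong refl)

lemma space_lambda_pow:
  "sets lam = sets borel \<Longrightarrow> space (lambda_pow lam R) = space (prod_space R)"
  by (rule sets_eq_imp_space_eq[OF sets_lambda_pow])

lemma measurable_pull:
  assumes lam: "sets lam = sets borel" and f: "\<And>v. v \<in> V \<Longrightarrow> f v \<in> R"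
  shows "pull f V \<in> lambda_pow lam R \<rightarrow>\<^sub>M prod_space V"
proof -
  have "(\<lambda>x. x (f v)) \<in> PiM R (\<lambda>_. lam) \<rightarrow>\<^sub>M borel" if "v \<in> V" for v
    using measurable_component_singleton[OF f[OF that], of "\<lambda>_. lam"]
      measurable_cong_sets[OF refl lam] by blast
  then show ?thesis
    unfolding pull_def[abs_def] lambda_pow_def prod_space_def by (rule measurable_restrict)
qed

lemma measurable_indicator_pull:
  assumes "sets lam = sets borel" "\<And>v. v \<in> V \<Longrightarrow> f v \<in> R" "A \<in> sets (prod_space V)"
  shows "(\<lambda>w. indicator A (pull f V w) :: ennreal) \<in> borel_measurable (lambda_pow lam R)"
  using measurable_compose[OF measurable_pull[OF assms(1,2)] borel_measurable_indicator[OF assms(3)]] .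

lemma measurable_merge_lambda_pow:
  "merge \<alpha> \<rho> \<in> lambda_pow lam \<alpha> \<Otimes>\<^sub>M lambda_pow lam \<rho> \<rightarrow>\<^sub>M lambda_pow lam (\<alpha> \<union> \<rho>)"
  unfolding lambda_pow_def by (rule measurable_merge)

text \<open>All factors of the power are equal, so renaming coordinates preserves it. Boxes suffice
  for the check because \<open>lam\<close> is sigma-finite, and the preimage of a box is the renamed
  box.\<close>

lemma lambda_pow_reindex:
  fixes lam :: "'a::t2_space measure"
  assumes lam: "sigma_finite_measure lam" and fin: "finite R" and \<phi>: "bij_betw \<phi> R R'"
  shows "distr (lambda_pow lam R') (lambda_pow lam R) (\<lambda>w. \<lambda>r\<in>R. w (\<phi> r)) = lambda_pow lam R"
proof -
  interpret product_sigma_finite "\<lambda>_::'b. lam"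
    using lam by (simp add: product_sigma_finite_def)
  interpret Q: product_sigma_finite "\<lambda>_::'c. lam"
    using lam by (simp add: product_sigma_finite_def)
  have fin': "finite R'" using \<phi> fin bij_betw_finite by blast
  have in': "\<phi> r \<in> R'" if "r \<in> R" for r using bij_betwE[OF \<phi>] that by blast
  have meas: "(\<lambda>w. \<lambda>r\<in>R. w (\<phi> r)) \<in> PiM R' (\<lambda>_. lam) \<rightarrow>\<^sub>M PiM R (\<lambda>_. lam)"
    using in' by (intro measurable_restrict measurable_component_singleton)
  have "distr (PiM R' (\<lambda>_. lam)) (PiM R (\<lambda>_. lam)) (\<lambda>w. \<lambda>r\<in>R. w (\<phi> r)) = PiM R (\<lambda>_. lam)"
  proof (rule PiM_eqI[OF fin])
    fix A assume A: "\<And>i. i \<in> R \<Longrightarrow> A i \<in> sets lam"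
    let ?g = "inv_into R \<phi>"
    have g: "bij_betw ?g R' R" using \<phi> by (rule bij_betw_inv_into)
    have g_in: "?g s \<in> R" if "s \<in> R'" for s using bij_betwE[OF g] that by blast
    have pre: "(\<lambda>w. \<lambda>r\<in>R. w (\<phi> r)) -` PiE R A \<inter> space (PiM R' (\<lambda>_. lam)) = PiE R' (\<lambda>s. A (?g s))"
    proof (rule set_eqI)
      fix w
      have "(\<forall>r\<in>R. w (\<phi> r) \<in> A r) \<longleftrightarrow> (\<forall>s\<in>R'. w s \<in> A (?g s))"
        using in' g_in bij_betw_inv_into_right[OF \<phi>] bij_betw_inv_into_left[OF \<phi>] by metis
      moreover have "w s \<in> space lam" if "s \<in> R'" "w s \<in> A (?g s)" for s
        using sets.sets_into_space[OF A[OF g_in[OF that(1)]]] that(2) by blast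
      ultimately show "w \<in> (\<lambda>w. \<lambda>r\<in>R. w (\<phi> r)) -` PiE R A \<inter> space (PiM R' (\<lambda>_. lam)) \<longleftrightarrow>
          w \<in> PiE R' (\<lambda>s. A (?g s))"
        by (auto simp: space_PiM PiE_iff)
    qed
    have "emeasure (distr (PiM R' (\<lambda>_. lam)) (PiM R (\<lambda>_. lam)) (\<lambda>w. \<lambda>r\<in>R. w (\<phi> r))) (PiE R A) =
        emeasure (PiM R' (\<lambda>_. lam)) (PiE R' (\<lambda>s. A (?g s)))"
      using A fin by (subst emeasure_distr[OF meas]) (auto simp: pre intro!: sets_PiM_I_finite)
    also have "\<dots> = (\<Prod>s\<in>R'. emeasure lam (A (?g s)))"
      using A g_in fin' by (intro Q.emeasure_PiM) auto
    also have "\<dots> = (\<Prod>r\<in>R. emeasure lam (A r))"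
      by (rule prod.reindex_bij_betw[OF g])
    finally show "emeasure (distr (PiM R' (\<lambda>_. lam)) (PiM R (\<lambda>_. lam)) (\<lambda>w. \<lambda>r\<in>R. w (\<phi> r))) (PiE R A) =
      (\<Prod>i\<in>R. emeasure lam (A i))" .
  qed simp
  then show ?thesis by (simp add: lambda_pow_def)
qed

text \<open>The image of a power of \<lambda> under a root map does not depend on which
  representatives serve as roots: \<open>f'\<close> and \<open>f\<close> use the root sets
  \<open>R\<close> and \<open>R'\<close>, matched by \<open>\<phi>\<close>.\<close>

lemma nn_integral_pull_reindex:
  assumes lam: "sigma_finite_measure lam" "sets lam = sets borel" and fin: "finite R"
    and \<phi>: "bij_betw \<phi> R R'"
    and f': "\<And>v. v \<in> V \<Longrightarrow> f' v \<in> R" and f: "\<And>v. v \<in> V \<Longrightarrow> f v = \<phi> (f' v)"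
    and A: "A \<in> sets (prod_space V)"
  shows "(\<integral>\<^sup>+ w. indicator A (pull f V w) \<partial>lambda_pow lam R') = (\<integral>\<^sup>+ x. indicator A (pull f' V x) \<partial>lambda_pow lam R)"
proof -
  have in': "\<phi> r \<in> R'" if "r \<in> R" for r using bij_betwE[OF \<phi>] that by blast
  have meas: "(\<lambda>w. \<lambda>r\<in>R. w (\<phi> r)) \<in> lambda_pow lam R' \<rightarrow>\<^sub>M lambda_pow lam R"
    unfolding lambda_pow_def using in' by (intro measurable_restrict measurable_component_singleton)
  have ind: "(\<lambda>x. indicator A (pull f' V x) :: ennreal) \<in> borel_measurable (lambda_pow lam R)"
    by (rule measurable_indicator_pull[OF lam(2) f' A])
  have pull: "pull f V w = pull f' V (\<lambda>r\<in>R. w (\<phi> r))" for w :: "'b \<Rightarrow> 'a"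
    using f f' by (auto simp: pull_def fun_eq_iff)
  have "(\<integral>\<^sup>+ x. indicator A (pull f' V x) \<partial>lambda_pow lam R) =
      (\<integral>\<^sup>+ x. indicator A (pull f' V x) \<partial>distr (lambda_pow lam R') (lambda_pow lam R) (\<lambda>w. \<lambda>r\<in>R. w (\<phi> r)))"
    by (simp only: lambda_pow_reindex[OF lam(1) fin \<phi>])
  also have "\<dots> = (\<integral>\<^sup>+ w. indicator A (pull f V w) \<partial>lambda_pow lam R')"
    unfolding pull by (subst nn_integral_distr[OF meas]) (simp_all add: ind)
  finally show ?thesis by simp
qed

text \<open>The measurability assumption makes the integrated set function countably additive, so
  that \<open>measure_on\<close> really takes the intended values.\<close>

lemma emeasure_times_lambda:
  assumes lam: "sets lam = sets borel"
    and K: "\<And>x. sets (K x) = sets (prod_space \<pi>)"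
    and meas: "\<And>A. A \<in> sets (prod_space (\<pi> \<union> \<rho>)) \<Longrightarrow>
      (\<lambda>x. emeasure (K x) ((\<lambda>y. merge \<pi> \<rho> (y, x)) -` A \<inter> space (prod_space \<pi>))) \<in> borel_measurable (lambda_pow lam \<rho>)"
    and A: "A \<in> sets (prod_space (\<pi> \<union> \<rho>))"
  shows "emeasure (times_lambda lam \<pi> \<rho> K) A =
    (\<integral>\<^sup>+ x. emeasure (K x) ((\<lambda>y. merge \<pi> \<rho> (y, x)) -` A \<inter> space (prod_space \<pi>)) \<partial>lambda_pow lam \<rho>)"
proof -
  have distr: "emeasure (distr (K x) (prod_space (\<pi> \<union> \<rho>)) (\<lambda>y. merge \<pi> \<rho> (y, x))) B =
      emeasure (K x) ((\<lambda>y. merge \<pi> \<rho> (y, x)) -` B \<inter> space (prod_space \<pi>))"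
    if x: "x \<in> space (lambda_pow lam \<rho>)" and B: "B \<in> sets (prod_space (\<pi> \<union> \<rho>))" for x B
  proof -
    have "(\<lambda>y. (y, x)) \<in> prod_space \<pi> \<rightarrow>\<^sub>M prod_space \<pi> \<Otimes>\<^sub>M prod_space \<rho>"
      using x by (intro measurable_Pair2') (simp add: space_lambda_pow[OF lam])
    moreover have "merge \<pi> \<rho> \<in> prod_space \<pi> \<Otimes>\<^sub>M prod_space \<rho> \<rightarrow>\<^sub>M prod_space (\<pi> \<union> \<rho>)"
      unfolding prod_space_def by (rule measurable_merge)
    ultimately have "(\<lambda>y. merge \<pi> \<rho> (y, x)) \<in> prod_space \<pi> \<rightarrow>\<^sub>M prod_space (\<pi> \<union> \<rho>)"
      by (rule measurable_compose)
    then have "(\<lambda>y. merge \<pi> \<rho> (y, x)) \<in> K x \<rightarrow>\<^sub>M prod_space (\<pi> \<union> \<rho>)"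
      using measurable_cong_sets[OF K refl] by blast
    then show ?thesis
      using B sets_eq_imp_space_eq[OF K] by (simp add: emeasure_distr)
  qed
  have "emeasure (times_lambda lam \<pi> \<rho> K) A =
      (\<integral>\<^sup>+ x. emeasure (distr (K x) (prod_space (\<pi> \<union> \<rho>)) (\<lambda>y. merge \<pi> \<rho> (y, x))) A \<partial>lambda_pow lam \<rho>)"
    unfolding times_lambda_def
  proof (rule emeasure_measure_on_integral[OF _ _ A])
    fix B :: "('b \<Rightarrow> 'a) set" assume B: "B \<in> sets (prod_space (\<pi> \<union> \<rho>))"
    show "(\<lambda>x. emeasure (distr (K x) (prod_space (\<pi> \<union> \<rho>)) (\<lambda>y. merge \<pi> \<rho> (y, x))) B) \<in> borel_measurable (lambda_pow lam \<rho>)"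
      using meas[OF B] by (subst measurable_cong[OF distr[OF _ B]])
  qed simp
  also have "\<dots> = (\<integral>\<^sup>+ x. emeasure (K x) ((\<lambda>y. merge \<pi> \<rho> (y, x)) -` A \<inter> space (prod_space \<pi>)) \<partial>lambda_pow lam \<rho>)"
    by (intro nn_integral_cong distr A)
  finally show ?thesis .
qed

section \<open>Bound variables and the integral over them\<close>

lemma fresh_indices:
  fixes V :: "'i::infinite set"
  assumes "finite V"
  shows "finite (fresh_indices V n)" "card (fresh_indices V n) = n" "fresh_indices V n \<inter> V = {}"
proof -
  have "infinite (UNIV - V)"
    using assms infinite_UNIV by (intro Diff_infinite_finite)
  then obtain \<alpha> where "finite \<alpha>" "card \<alpha> = n" "\<alpha> \<subseteq> UNIV - V"
    using infinite_arbitrarily_large by blast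
  then have "\<exists>\<alpha>. finite \<alpha> \<and> card \<alpha> = n \<and> \<alpha> \<inter> V = {}" by blast
  from someI_ex[OF this] show "finite (fresh_indices V n)" "card (fresh_indices V n) = n" "fresh_indices V n \<inter> V = {}"
    unfolding fresh_indices_def by auto
qed

text \<open>Only the term with \<open>N\<close> particles survives. The definition keeps the empty
  index set apart from a series that begins at one particle, hence the case distinction; for
  \<open>N = Suc m\<close> the surviving summand has index \<open>m\<close>.\<close>

lemma lambda_integral_eq:
  assumes V: "finite V" and g: "\<And>\<alpha> y. finite \<alpha> \<Longrightarrow> card \<alpha> \<noteq> N \<Longrightarrow> g \<alpha> y = 0"
  shows "lambda_integral lam V g =
    ennreal (1 / fact N) * (\<integral>\<^sup>+ y. g (fresh_indices V N) y \<partial>lambda_pow lam (fresh_indices V N))"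
proof -
  have g0: "g (fresh_indices V n) = (\<lambda>_. 0)" if "n \<noteq> N" for n
    using g fresh_indices[OF V, of n] that by (intro ext) simp
  have empty: "fresh_indices V 0 = {}"
    using fresh_indices(1,2)[OF V, of 0] by simp
  show ?thesis
  proof (cases N)
    case 0
    \<comment> \<open>The empty power of \<lambda> is the unit mass at the empty tuple, represented
      by the constant function \<open>undefined\<close>; so the separate first term is an integral
      as well.\<close>
    have "(\<integral>\<^sup>+ y. g {} y \<partial>lambda_pow lam {}) = g {} (\<lambda>_. undefined)"
      by (simp add: lambda_pow_def PiM_empty nn_integral_count_space_finite)
    then show ?thesis
      using g0 unfolding lambda_integral_def by (simp add: 0 empty)
  next
    case (Suc m)
    have "(\<Sum>n. ennreal (1 / fact (Suc n)) *
        (\<integral>\<^sup>+ y. g (fresh_indices V (Suc n)) y \<partial>lambda_pow lam (fresh_indices V (Suc n)))) =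
      (\<Sum>n\<in>{m}. ennreal (1 / fact (Suc n)) *
        (\<integral>\<^sup>+ y. g (fresh_indices V (Suc n)) y \<partial>lambda_pow lam (fresh_indices V (Suc n))))"
      using g0 Suc by (intro suminf_finite) auto
    moreover have "g {} (\<lambda>_. undefined) = 0"
      using g Suc by simp
    ultimately show ?thesis
      unfolding lambda_integral_def by (simp add: Suc)
  qed
qed

text \<open>Countably many compact sets cover the space; they have finite measure and, being closed
  in a Hausdorff space, are Borel sets.\<close>

lemma sigma_finite_radon_measure:
  assumes "countable_at_infinity TYPE('a::t2_space)" "radon_measure (lam :: 'a measure)"
  shows "sigma_finite_measure lam"
proof -
  obtain K :: "nat \<Rightarrow> 'a set" where K: "\<And>n. compact (K n)" "(\<Union>n. K n) = UNIV"
    using assms(1) by (auto simp: countable_at_infinity_def)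
  have lam: "sets lam = sets borel" "\<And>C. compact C \<Longrightarrow> emeasure lam C < \<infinity>"
    using assms(2) by (auto simp: radon_measure_def)
  have "space lam = UNIV"
    using sets_eq_imp_space_eq[OF lam(1)] by simp
  moreover have "K n \<in> sets lam" for n
    using K(1)[of n] by (simp add: lam(1) borel_closed compact_imp_closed)
  moreover have "emeasure lam (K n) \<noteq> \<infinity>" for n
    using lam(2)[OF K(1)[of n]] by auto
  ultimately show ?thesis
    using K(2) by (intro sigma_finite_measure.intro exI[of _ "range K"]) auto
qed

section \<open>Both sides as sums over contractions\<close>

locale lambda_two_sequences = two_sequences W1 W2
  for W1 W2 :: "'i::infinite oper list" +
  fixes lam :: "'a::t2_space measure"
  assumes sigma_finite: "sigma_finite_measure lam" and sets_lam: "sets lam = sets borel"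
begin

abbreviation "\<pi> \<equiv> omega_plus W1 \<union> omega_plus W2"
abbreviation "\<rho> \<equiv> \<rho>1 \<union> \<rho>2"
text \<open>The number of particles in \<open>M \<Phi>\<close> for \<open>W1\<close>. If
  \<open>W1\<close> has more annihilators than creators, the truncated difference is 0, but then
  \<open>W1\<close> has no contractions at all.\<close>

abbreviation "N \<equiv> card (omega_plus W1) - card (omega_minus W1)"
text \<open>The set to be avoided is written as in \<open>lambda_pairing\<close>, so this is the
  very index set chosen there for \<open>N\<close> particles.\<close>

definition "\<alpha> = fresh_indices (omega_plus W1 \<union> \<rho>1 \<union> omega_plus W2 \<union> \<rho>2) N"
abbreviation "pairing_kernel x \<equiv> lambda_pairing lam (omega_plus W1) \<rho>1 (monomial_Phi W1) (omega_plus W2) \<rho>2 (monomial_Phi W2) x"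

lemma fresh_alpha: "finite \<alpha>" "card \<alpha> = N" "\<alpha> \<inter> indices = {}"
proof -
  have "finite (omega_plus W1 \<union> \<rho>1 \<union> omega_plus W2 \<union> \<rho>2)" by simp
  from fresh_indices[OF this, of N] show "finite \<alpha>" "card \<alpha> = N" "\<alpha> \<inter> indices = {}"
    unfolding \<alpha>_def by blast+
qed

text \<open>The product of two point masses sits at the merged tuple; \<open>merge\<close> consults
  the first factor first, in agreement with the order of cases in \<open>joint_root\<close>.\<close>

lemma emeasure_product_monomials:
  assumes \<upsilon>: "finite \<upsilon>" and A: "A \<in> sets (prod_space \<pi>)"
  shows "emeasure (product_measure (omega_plus W1) (monomial_Phi W1 \<upsilon> z) (omega_plus W2) (monomial_Phi W2 \<upsilon> z)) A =
    (\<Sum>j\<in>particle_terms W1 \<upsilon>. \<Sum>k\<in>particle_terms W2 \<upsilon>. indicator A (pull (joint_root j k) \<pi> z))"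
proof -
  have "merge (omega_plus W1) (omega_plus W2)
      (pull (chain_root (particle_graph W1 j)) (omega_plus W1) z, pull (chain_root (particle_graph W2 k)) (omega_plus W2) z) =
      pull (joint_root j k) \<pi> z" for j k
    by (auto simp: fun_eq_iff merge_def pull_def joint_root_def)
  then show ?thesis
    using \<upsilon> A
    by (subst emeasure_product_measure_dirac_sum[where ?J1.0 = "particle_terms W1 \<upsilon>" and ?J2.0 = "particle_terms W2 \<upsilon>"
          and ?p1.0 = "\<lambda>j. pull (chain_root (particle_graph W1 j)) (omega_plus W1) z"
          and ?p2.0 = "\<lambda>k. pull (chain_root (particle_graph W2 k)) (omega_plus W2) z"])
      (simp_all add: emeasure_monomial_Phi adm1 adm2)
qed

lemma particle_terms_empty:
  assumes "card \<upsilon> \<noteq> N"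
  shows "particle_terms W1 \<upsilon> = {}"
proof -
  have "bijections (omega_plus W1 - snd ` S) \<upsilon> = {}" if "S \<in> contractions W1" for S
    using card_contraction_complement[OF that] bij_betw_same_card assms
    by (fastforce simp: bijections_def)
  then show ?thesis by (auto simp: particle_terms_def)
qed

lemma joint_root_in:
  assumes "j \<in> particle_terms W1 \<alpha>" "k \<in> particle_terms W2 \<alpha>" "v \<in> indices"
  shows "joint_root j k v \<in> \<alpha> \<union> \<rho>"
  using joint_root_bij(4)[OF assms(1,2) fresh_alpha(3) assms(3)] .

lemma measurable_merge_fixed:
  assumes f: "f \<in> borel_measurable (lambda_pow lam (\<alpha> \<union> \<rho>))" and x: "x \<in> space (lambda_pow lam \<rho>)"
  shows "(\<lambda>y. f (merge \<alpha> \<rho> (y, x))) \<in> borel_measurable (lambda_pow lam \<alpha>)"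
  using measurable_compose[OF measurable_compose[OF measurable_Pair2'[OF x] measurable_merge_lambda_pow] f] .

text \<open>Terms of \<open>W1\<close> exist only over index sets with \<open>N\<close> elements, so
  the pairing reduces to a single integral over the variables in \<alpha>.\<close>

lemma emeasure_pairing_kernel:
  assumes x: "x \<in> space (lambda_pow lam \<rho>)" and A: "A \<in> sets (prod_space \<pi>)"
  shows "emeasure (pairing_kernel x) A = (\<integral>\<^sup>+ y. ennreal (1 / fact N) *
    (\<Sum>j\<in>particle_terms W1 \<alpha>. \<Sum>k\<in>particle_terms W2 \<alpha>. indicator A (pull (joint_root j k) \<pi> (merge \<alpha> \<rho> (y, x))))
      \<partial>lambda_pow lam \<alpha>)"
proof -
  let ?c = "ennreal (1 / fact N)"
  let ?P = "\<lambda>\<upsilon> y. product_measure (omega_plus W1) (monomial_Phi W1 \<upsilon> (merge \<upsilon> \<rho> (y, x)))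
    (omega_plus W2) (monomial_Phi W2 \<upsilon> (merge \<upsilon> \<rho> (y, x)))"
  have meas: "(\<lambda>y. \<Sum>j\<in>particle_terms W1 \<alpha>. \<Sum>k\<in>particle_terms W2 \<alpha>.
      indicator B (pull (joint_root j k) \<pi> (merge \<alpha> \<rho> (y, x))) :: ennreal) \<in> borel_measurable (lambda_pow lam \<alpha>)"
    if B: "B \<in> sets (prod_space \<pi>)" for B
    by (intro borel_measurable_sum measurable_merge_fixed[OF _ x] measurable_indicator_pull[OF sets_lam _ B]
        joint_root_in) blast+
  have P: "emeasure (?P \<alpha> y) B = (\<Sum>j\<in>particle_terms W1 \<alpha>. \<Sum>k\<in>particle_terms W2 \<alpha>.
      indicator B (pull (joint_root j k) \<pi> (merge \<alpha> \<rho> (y, x))))" if "B \<in> sets (prod_space \<pi>)" for B y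
    by (rule emeasure_product_monomials[OF fresh_alpha(1) that])
  \<comment> \<open>The factor \<open>1 / fact N\<close> is absorbed into the measures, so that the
    set function becomes an integral of measures and its countable additivity is available.\<close>
  have eq: "pairing_kernel x = measure_on \<pi> (\<lambda>B. \<integral>\<^sup>+ y. emeasure (scale_measure ?c (?P \<alpha> y)) B \<partial>lambda_pow lam \<alpha>)"
    unfolding lambda_pairing_def Let_def
  proof (rule measure_on_cong)
    fix B :: "('i \<Rightarrow> 'a) set" assume B: "B \<in> sets (prod_space \<pi>)"
    have "lambda_integral lam (omega_plus W1 \<union> \<rho>1 \<union> omega_plus W2 \<union> \<rho>2) (\<lambda>\<upsilon> y. emeasure (?P \<upsilon> y) B) =
        ?c * (\<integral>\<^sup>+ y. emeasure (?P \<alpha> y) B \<partial>lambda_pow lam \<alpha>)"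
      using emeasure_product_monomials[OF _ B] particle_terms_empty unfolding \<alpha>_def by (intro lambda_integral_eq) simp_all
    also have "\<dots> = (\<integral>\<^sup>+ y. emeasure (scale_measure ?c (?P \<alpha> y)) B \<partial>lambda_pow lam \<alpha>)"
      using meas[OF B] by (simp add: P[OF B] nn_integral_cmult)
    finally show "lambda_integral lam (omega_plus W1 \<union> \<rho>1 \<union> omega_plus W2 \<union> \<rho>2) (\<lambda>\<upsilon> y. emeasure (?P \<upsilon> y) B) =
      (\<integral>\<^sup>+ y. emeasure (scale_measure ?c (?P \<alpha> y)) B \<partial>lambda_pow lam \<alpha>)" .
  qed
  have "emeasure (pairing_kernel x) A = (\<integral>\<^sup>+ y. emeasure (scale_measure ?c (?P \<alpha> y)) A \<partial>lambda_pow lam \<alpha>)"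
    unfolding eq
  proof (rule emeasure_measure_on_integral[OF _ _ A])
    fix B :: "('i \<Rightarrow> 'a) set" assume B: "B \<in> sets (prod_space \<pi>)"
    show "(\<lambda>y. emeasure (scale_measure ?c (?P \<alpha> y)) B) \<in> borel_measurable (lambda_pow lam \<alpha>)"
      using meas[OF B] by (simp add: P[OF B])
  qed (simp add: product_measure_def)
  then show ?thesis
    by (simp only: emeasure_scale_measure P[OF A])
qed

text \<open>A change of variables along \<open>joint_root j k\<close>, which carries the roots of
  the glued graph to those of the two particle graphs.\<close>

lemma nn_integral_glue:
  assumes j: "j \<in> particle_terms W1 \<alpha>" and k: "k \<in> particle_terms W2 \<alpha>" and A: "A \<in> sets (prod_space indices)"
  shows "(\<integral>\<^sup>+ w. indicator A (pull (joint_root j k) indices w) \<partial>lambda_pow lam (\<alpha> \<union> \<rho>)) =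
    (\<integral>\<^sup>+ x. indicator A (pull (chain_root (glue j k)) indices x) \<partial>lambda_pow lam \<rho>0)"
  using joint_root_bij[OF j k fresh_alpha(3)]
  by (intro nn_integral_pull_reindex[OF sigma_finite sets_lam _ _ _ _ A, of _ "joint_root j k"])
    (simp_all only: finite_Diff finite_omega)

text \<open>By Fubini the integrals over \<rho> and \<alpha> become one power of \<lambda>. After
  the change of variables a term depends on \<open>j\<close> and \<open>k\<close> only through
  \<open>glue j k\<close>, and the multiplicity \<open>fact N\<close> cancels the weight.\<close>

lemma emeasure_times_pairing_kernel:
  assumes A: "A \<in> sets (prod_space indices)"
  shows "emeasure (times_lambda lam \<pi> \<rho> pairing_kernel) A =
    (\<Sum>S\<in>full_contractions. \<integral>\<^sup>+ x. indicator A (pull (chain_root S) indices x) \<partial>lambda_pow lam \<rho>0)"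
proof -
  interpret product_sigma_finite "\<lambda>_::'i. lam"
    using sigma_finite by (simp add: product_sigma_finite_def)
  interpret L: sigma_finite_measure "lambda_pow lam \<alpha>"
    unfolding lambda_pow_def using fresh_alpha(1) by (rule sigma_finite)
  let ?c = "ennreal (1 / fact N)"
  define H :: "('i \<Rightarrow> 'a) set \<Rightarrow> ('i \<Rightarrow> 'a) \<Rightarrow> ennreal" where
    "H B w = ?c * (\<Sum>j\<in>particle_terms W1 \<alpha>. \<Sum>k\<in>particle_terms W2 \<alpha>. indicator B (pull (joint_root j k) indices w))" for B w
  have disj: "\<alpha> \<inter> \<rho> = {}" "\<pi> \<inter> \<rho> = {}" using fresh_alpha(3) disjoint_omega by auto
  have ind: "(\<lambda>w. indicator B (pull (joint_root j k) indices w) :: ennreal) \<in> borel_measurable (lambda_pow lam (\<alpha> \<union> \<rho>))"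
    if "B \<in> sets (prod_space indices)" "j \<in> particle_terms W1 \<alpha>" "k \<in> particle_terms W2 \<alpha>" for B j k
    using that by (intro measurable_indicator_pull[OF sets_lam] joint_root_in)
  have H: "H B \<in> borel_measurable (lambda_pow lam (\<alpha> \<union> \<rho>))" if B: "B \<in> sets (prod_space indices)" for B
    unfolding H_def[abs_def] using ind[OF B] by (intro borel_measurable_times_ennreal borel_measurable_sum) auto
  have kernel: "emeasure (pairing_kernel x) ((\<lambda>y. merge \<pi> \<rho> (y, x)) -` B \<inter> space (prod_space \<pi>)) =
      (\<integral>\<^sup>+ y. H B (merge \<alpha> \<rho> (y, x)) \<partial>lambda_pow lam \<alpha>)"
    if x: "x \<in> space (lambda_pow lam \<rho>)" and B: "B \<in> sets (prod_space indices)" for x B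
  proof -
    let ?B = "(\<lambda>y. merge \<pi> \<rho> (y, x)) -` B \<inter> space (prod_space \<pi>)"
    have x': "x \<in> space (prod_space \<rho>)" using x by (simp add: space_lambda_pow[OF sets_lam])
    have "(\<lambda>y. merge \<pi> \<rho> (y, x)) \<in> prod_space \<pi> \<rightarrow>\<^sub>M prod_space indices"
      using measurable_compose[OF measurable_Pair2'[OF x'[unfolded prod_space_def]] measurable_merge]
      unfolding prod_space_def .
    then have B': "?B \<in> sets (prod_space \<pi>)" using B by (rule measurable_sets)
    \<comment> \<open>Indices in \<rho> are their own joint roots and take their values from
      \<open>x\<close>, so the point on \<pi> extends to all indices by the same
      substitution.\<close>
    have "merge \<pi> \<rho> (pull (joint_root j k) \<pi> (merge \<alpha> \<rho> (y, x)), x) = pull (joint_root j k) indices (merge \<alpha> \<rho> (y, x))" for j k y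
    proof
      fix v
      show "merge \<pi> \<rho> (pull (joint_root j k) \<pi> (merge \<alpha> \<rho> (y, x)), x) v = pull (joint_root j k) indices (merge \<alpha> \<rho> (y, x)) v"
      proof (cases "v \<in> \<rho>")
        case True
        then have v: "v \<notin> omega_plus W1" "v \<notin> omega_plus W2" "v \<notin> \<alpha>" using disj by blast+
        then show ?thesis using True by (simp add: merge_def pull_def joint_root_def)
      next
        case False
        then show ?thesis by (simp add: merge_def pull_def)
      qed
    qed
    then have "indicator ?B (pull (joint_root j k) \<pi> (merge \<alpha> \<rho> (y, x))) =
        (indicator B (pull (joint_root j k) indices (merge \<alpha> \<rho> (y, x))) :: ennreal)" for j k y
      by (simp add: indicator_def)
    then show ?thesis
      unfolding emeasure_pairing_kernel[OF x B'] H_def by simp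
  qed
  have "emeasure (times_lambda lam \<pi> \<rho> pairing_kernel) A =
      (\<integral>\<^sup>+ x. emeasure (pairing_kernel x) ((\<lambda>y. merge \<pi> \<rho> (y, x)) -` A \<inter> space (prod_space \<pi>)) \<partial>lambda_pow lam \<rho>)"
  proof (rule emeasure_times_lambda[OF sets_lam _ _ A])
    fix B :: "('i \<Rightarrow> 'a) set" assume B: "B \<in> sets (prod_space (\<pi> \<union> \<rho>))"
    have "(\<lambda>x. \<integral>\<^sup>+ y. H B (merge \<alpha> \<rho> (y, x)) \<partial>lambda_pow lam \<alpha>) \<in> borel_measurable (lambda_pow lam \<rho>)"
    proof (rule L.borel_measurable_nn_integral)
      have "(\<lambda>p. (snd p, fst p)) \<in> lambda_pow lam \<rho> \<Otimes>\<^sub>M lambda_pow lam \<alpha> \<rightarrow>\<^sub>M lambda_pow lam \<alpha> \<Otimes>\<^sub>M lambda_pow lam \<rho>"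
        by measurable
      from measurable_compose[OF measurable_compose[OF this measurable_merge_lambda_pow] H[OF B]]
      show "case_prod (\<lambda>x y. H B (merge \<alpha> \<rho> (y, x))) \<in> borel_measurable (lambda_pow lam \<rho> \<Otimes>\<^sub>M lambda_pow lam \<alpha>)"
        by (simp add: case_prod_beta')
    qed
    then show "(\<lambda>x. emeasure (pairing_kernel x) ((\<lambda>y. merge \<pi> \<rho> (y, x)) -` B \<inter> space (prod_space \<pi>))) \<in> borel_measurable (lambda_pow lam \<rho>)"
      by (subst measurable_cong[OF kernel[OF _ B]])
  qed (simp add: lambda_pairing_def)
  also have "\<dots> = (\<integral>\<^sup>+ x. \<integral>\<^sup>+ y. H A (merge \<alpha> \<rho> (y, x)) \<partial>lambda_pow lam \<alpha> \<partial>lambda_pow lam \<rho>)"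
    by (intro nn_integral_cong kernel A)
  \<comment> \<open>The outer variables must come first for Fubini; \<open>merge\<close> may be
    swapped because \<alpha> and \<rho> are disjoint.\<close>
  also have "\<dots> = (\<integral>\<^sup>+ x. \<integral>\<^sup>+ y. H A (merge \<rho> \<alpha> (x, y)) \<partial>lambda_pow lam \<alpha> \<partial>lambda_pow lam \<rho>)"
    by (simp only: merge_commute[OF disj(1)])
  also have "\<dots> = (\<integral>\<^sup>+ w. H A w \<partial>lambda_pow lam (\<alpha> \<union> \<rho>))"
    using product_nn_integral_fold[of \<rho> \<alpha> "H A"] disj fresh_alpha(1) H[OF A]
    unfolding lambda_pow_def by (simp add: Un_commute Int_commute)
  also have "\<dots> = ?c * (\<Sum>j\<in>particle_terms W1 \<alpha>. \<Sum>k\<in>particle_terms W2 \<alpha>.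
      \<integral>\<^sup>+ w. indicator A (pull (joint_root j k) indices w) \<partial>lambda_pow lam (\<alpha> \<union> \<rho>))"
    unfolding H_def using ind[OF A]
    by (simp add: nn_integral_cmult nn_integral_sum)
  also have "\<dots> = ?c * (\<Sum>j\<in>particle_terms W1 \<alpha>. \<Sum>k\<in>particle_terms W2 \<alpha>.
      \<integral>\<^sup>+ x. indicator A (pull (chain_root (glue j k)) indices x) \<partial>lambda_pow lam \<rho>0)"
    using A by (intro arg_cong[where f = "\<lambda>t. ?c * t"] sum.cong refl nn_integral_glue)
  also have "\<dots> = ?c * (of_nat (fact N) *
      (\<Sum>S\<in>full_contractions. \<integral>\<^sup>+ x. indicator A (pull (chain_root S) indices x) \<partial>lambda_pow lam \<rho>0))"
    by (subst sum_glue[OF fresh_alpha(1,2), where f = "\<lambda>S. \<integral>\<^sup>+ x. indicator A (pull (chain_root S) indices x) \<partial>lambda_pow lam \<rho>0"])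
      (simp only: fresh_alpha(2))
  also have "\<dots> = (?c * of_nat (fact N)) *
      (\<Sum>S\<in>full_contractions. \<integral>\<^sup>+ x. indicator A (pull (chain_root S) indices x) \<partial>lambda_pow lam \<rho>0)"
    by (simp only: mult.assoc)
  also have "?c * of_nat (fact N) = 1"
  proof -
    have "?c * of_nat (fact N) = ennreal (1 / fact N) * ennreal (fact N)"
      by (simp only: of_nat_fact ennreal_of_nat_eq_real_of_nat)
    also have "\<dots> = 1"
      by (subst ennreal_mult[symmetric]) auto
    finally show ?thesis .
  qed
  finally show ?thesis by simp
qed

text \<open>The sum over pairings of positions is reindexed by the full contractions they
  define.\<close>

lemma emeasure_vacuum_expectation:
  assumes A: "A \<in> sets (prod_space (omega_plus W0))"
  shows "emeasure (vacuum_expectation W0 x) A =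
    (\<Sum>S\<in>full_contractions. indicator A (pull (chain_root S) (omega_plus W0) x))"
proof -
  note bij = bij_betw_pairing_graph[OF adm0, folded full_contractions_def]
  have S: "pairing_graph W0 P \<in> full_contractions" if "P \<in> pairings W0" for P
    using bij_betwE[OF bij] that by blast
  have plus: "S_plus S = omega_plus W0" "finite S" if "S \<in> full_contractions" for S
    using that full_contractionD(6)[OF that] by (simp_all add: full_contractions_def epsilon_graph_def)
  have "finite (pairings W0)"
    using bij_betw_finite[OF bij] by simp
  then have "emeasure (vacuum_expectation W0 x) A = (\<Sum>P\<in>pairings W0. emeasure (eps_prod (pairing_graph W0 P) x) A)"
    unfolding vacuum_expectation_def
    using A plus S by (intro emeasure_measure_on_sum) simp_all
  also have "\<dots> = (\<Sum>S\<in>full_contractions. emeasure (eps_prod S x) A)"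
    by (rule sum.reindex_bij_betw[OF bij])
  also have "\<dots> = (\<Sum>S\<in>full_contractions. indicator A (pull (chain_root S) (omega_plus W0) x))"
    using A plus by (intro sum.cong refl) (simp add: emeasure_eps_prod)
  finally show ?thesis .
qed

text \<open>Here no change of variables is required: a full contraction hits every label of
  \<open>omega_plus W0\<close>, so all roots already lie in \<open>\<rho>0\<close>.\<close>

lemma emeasure_times_vacuum:
  assumes A: "A \<in> sets (prod_space (omega_plus W0 \<union> \<rho>0))"
  shows "emeasure (times_lambda lam (omega_plus W0) \<rho>0 (vacuum_expectation W0)) A =
    (\<Sum>S\<in>full_contractions. \<integral>\<^sup>+ x. indicator A (pull (chain_root S) (omega_plus W0 \<union> \<rho>0) x) \<partial>lambda_pow lam \<rho>0)"
proof -
  let ?V = "omega_plus W0 \<union> \<rho>0"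
  have root: "chain_root S v \<in> \<rho>0" if "S \<in> full_contractions" "v \<in> ?V" for S v
  proof (cases "v \<in> S_plus S")
    case True
    then show ?thesis
      using chain_root_in[OF full_contractionD(6) True] full_contractionD(4,5) that by simp
  next
    case False
    then show ?thesis
      using that chain_root_id[OF False] by (simp add: full_contractions_def)
  qed
  have ind: "(\<lambda>x. indicator B (pull (chain_root S) ?V x) :: ennreal) \<in> borel_measurable (lambda_pow lam \<rho>0)"
    if "B \<in> sets (prod_space ?V)" "S \<in> full_contractions" for B S
    using root that by (intro measurable_indicator_pull[OF sets_lam])
  have vac: "emeasure (vacuum_expectation W0 x) ((\<lambda>y. merge (omega_plus W0) \<rho>0 (y, x)) -` B \<inter> space (prod_space (omega_plus W0))) =
      (\<Sum>S\<in>full_contractions. indicator B (pull (chain_root S) ?V x))"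
    if x: "x \<in> space (lambda_pow lam \<rho>0)" and B: "B \<in> sets (prod_space ?V)" for x B
  proof -
    let ?B = "(\<lambda>y. merge (omega_plus W0) \<rho>0 (y, x)) -` B \<inter> space (prod_space (omega_plus W0))"
    have x': "x \<in> space (prod_space \<rho>0)" using x by (simp add: space_lambda_pow[OF sets_lam])
    have "(\<lambda>y. merge (omega_plus W0) \<rho>0 (y, x)) \<in> prod_space (omega_plus W0) \<rightarrow>\<^sub>M prod_space ?V"
      using measurable_compose[OF measurable_Pair2'[OF x'[unfolded prod_space_def]] measurable_merge]
      unfolding prod_space_def .
    then have B': "?B \<in> sets (prod_space (omega_plus W0))" using B by (rule measurable_sets)
    have "merge (omega_plus W0) \<rho>0 (pull (chain_root S) (omega_plus W0) x, x) = pull (chain_root S) ?V x"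
      if S: "S \<in> full_contractions" for S
    proof
      fix v
      have "chain_root S v = v" if "v \<notin> omega_plus W0"
        using that S by (intro chain_root_id) (simp add: full_contractions_def)
      then show "merge (omega_plus W0) \<rho>0 (pull (chain_root S) (omega_plus W0) x, x) v = pull (chain_root S) ?V x v"
        unfolding merge_def pull_def by auto
    qed
    then have "indicator ?B (pull (chain_root S) (omega_plus W0) x) = (indicator B (pull (chain_root S) ?V x) :: ennreal)"
      if "S \<in> full_contractions" for S
      using that by (simp add: indicator_def)
    then show ?thesis
      unfolding emeasure_vacuum_expectation[OF B'] by (intro sum.cong refl)
  qed
  have "emeasure (times_lambda lam (omega_plus W0) \<rho>0 (vacuum_expectation W0)) A =
      (\<integral>\<^sup>+ x. emeasure (vacuum_expectation W0 x) ((\<lambda>y. merge (omega_plus W0) \<rho>0 (y, x)) -` A \<inter> space (prod_space (omega_plus W0)))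
        \<partial>lambda_pow lam \<rho>0)"
  proof (rule emeasure_times_lambda[OF sets_lam _ _ A])
    fix B :: "('i \<Rightarrow> 'a) set" assume B: "B \<in> sets (prod_space ?V)"
    have "(\<lambda>x. \<Sum>S\<in>full_contractions. indicator B (pull (chain_root S) ?V x) :: ennreal) \<in> borel_measurable (lambda_pow lam \<rho>0)"
      using ind[OF B] by (intro borel_measurable_sum)
    then show "(\<lambda>x. emeasure (vacuum_expectation W0 x) ((\<lambda>y. merge (omega_plus W0) \<rho>0 (y, x)) -` B \<inter>
        space (prod_space (omega_plus W0)))) \<in> borel_measurable (lambda_pow lam \<rho>0)"
      by (subst measurable_cong[OF vac[OF _ B]])
  qed (simp add: vacuum_expectation_def)
  also have "\<dots> = (\<integral>\<^sup>+ x. (\<Sum>S\<in>full_contractions. indicator A (pull (chain_root S) ?V x)) \<partial>lambda_pow lam \<rho>0)"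
    by (intro nn_integral_cong vac A)
  also have "\<dots> = (\<Sum>S\<in>full_contractions. \<integral>\<^sup>+ x. indicator A (pull (chain_root S) ?V x) \<partial>lambda_pow lam \<rho>0)"
    using ind[OF A] by (intro nn_integral_sum)
  finally show ?thesis .
qed

text \<open>Both sides are the same sum over full contractions. Adding \<rho> to \<pi> gives the
  same index set as adding \<open>\<rho>0\<close> to \<open>omega_plus W0\<close>, so the two
  measures live on the same space.\<close>

lemma times_pairing_kernel_eq_times_vacuum:
  "times_lambda lam \<pi> \<rho> pairing_kernel = times_lambda lam (omega_plus W0) \<rho>0 (vacuum_expectation W0)"
proof (rule measure_eqI)
  have V: "omega_plus W0 \<union> \<rho>0 = indices" by auto
  have sets: "sets (times_lambda lam \<pi> \<rho> pairing_kernel) = sets (prod_space indices)"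
    by (simp add: times_lambda_def)
  show "sets (times_lambda lam \<pi> \<rho> pairing_kernel) = sets (times_lambda lam (omega_plus W0) \<rho>0 (vacuum_expectation W0))"
    unfolding sets by (simp only: times_lambda_def sets_measure_on V)
  fix A assume "A \<in> sets (times_lambda lam \<pi> \<rho> pairing_kernel)"
  then have A: "A \<in> sets (prod_space indices)" by (simp only: sets)
  show "emeasure (times_lambda lam \<pi> \<rho> pairing_kernel) A =
      emeasure (times_lambda lam (omega_plus W0) \<rho>0 (vacuum_expectation W0)) A"
    using emeasure_times_pairing_kernel[OF A] emeasure_times_vacuum[unfolded V, OF A] by (simp only:)
qed

end

theorem theorem1p9p1:
  fixes lam :: "'a::t2_space measure"
    and W1 W2 :: "'i::infinite oper list"
  assumes "locally_compact_space (euclidean :: 'a topology)"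
    and "countable_at_infinity TYPE('a)"
    and "radon_measure lam"
    and "admissible W1" and "admissible W2"
    and "admissible (adjoint_seq W1 @ W2)"
  shows
    "(let W0 = adjoint_seq W1 @ W2;
          \<pi>0 = omega_plus W0; \<rho>0 = omega_minus W0 - omega_plus W0;
          \<pi>1 = omega_plus W1; \<rho>1 = omega_minus W1 - omega_plus W1;
          \<pi>2 = omega_plus W2; \<rho>2 = omega_minus W2 - omega_plus W2
      in (monomial_Phi W0 :: ('i, 'a) measure_fun) \<in> G_space \<pi>0 \<rho>0 \<and>
         (monomial_Phi W1 :: ('i, 'a) measure_fun) \<in> G_space \<pi>1 \<rho>1 \<and>
         (monomial_Phi W2 :: ('i, 'a) measure_fun) \<in> G_space \<pi>2 \<rho>2 \<and>
         \<pi>1 \<inter> \<pi>2 = {} \<and>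
         times_lambda lam (\<pi>1 \<union> \<pi>2) (\<rho>1 \<union> \<rho>2)
             (lambda_pairing lam \<pi>1 \<rho>1 (monomial_Phi W1) \<pi>2 \<rho>2 (monomial_Phi W2)) =
           times_lambda lam \<pi>0 \<rho>0 (vacuum_expectation W0))"
proof -
  interpret lambda_two_sequences W1 W2 lam
  proof (intro lambda_two_sequences.intro two_sequences.intro lambda_two_sequences_axioms.intro)
    show "admissible W1" "admissible W2" "admissible (adjoint_seq W1 @ W2)"
      by fact+
    show "sigma_finite_measure lam"
      using assms(2,3) by (rule sigma_finite_radon_measure)
    show "sets lam = sets borel"
      using assms(3) by (simp add: radon_measure_def)
  qed
  show ?thesis
    unfolding Let_def
    by (intro conjI monomial_Phi_in_G_space adm0 adm1 adm2 disjoint_omega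
        times_pairing_kernel_eq_times_vacuum)
qed

end
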